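(* Let $(X,d)$ be a compact metric space, $f:X\to X$ a continuous map and $X'\subseteq X$ an $f$-invariant subset. Assume $f$ satisfies the specification property on $X'$. Assume that $\varphi\in C(X)$ satisfies $\inf_{\mu\in\mathcal{M}_f(X')}\int\varphi\,d\mu<\sup_{\mu\in\mathcal{M}_f(X')}\int\varphi\,d\mu$. Let $$\widehat X_\varphi=\left\{x\in X:\lim_{n\to\infty}\frac1n\sum_{i=0}^{n-1}\varphi(f^i(x))\text{ does not exist}\right\}.$$ Then for all $\psi\in C(X)$, $$P_{\widehat X_\varphi}(\psi)\ \ge\ \sup\left\{h_\mu+\int\psi\,d\mu:\mu\in\mathcal{M}_f(X')\right\}.$$ If moreover $\sup\{h_\mu+\int\psi\,d\mu:\mu\in\mathcal{M}_f(X')\}=P_X^{classic}(\psi)$, then $P_{\widehat X_\varphi}(\psi)=P_X^{classic}(\psi)$.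
   Context: $C(X)$ is the space of continuous functions $X\to\mathbb{R}$; $\mathcal{M}_f(X)$ is the set of $f$-invariant Borel probability measures on $X$; for an $f$-invariant (not necessarily compact) $X'\subseteq X$, $\mathcal{M}_f(X')=\{\mu\in\mathcal{M}_f(X):\mu(X')=1\}$; $h_\mu$ is the measure-theoretic entropy of $f$ with respect to $\mu$. Specification property on $X'$: for all $\epsilon>0$ there is an integer $m=m(\epsilon)$ such that for any finite collection of finite integer intervals $I_j=[a_j,b_j]\subset\mathbb{N}$, $j=1,\dots,k$, with $a_{j+1}-b_j\ge m(\epsilon)$ for $j=1,\dots,k-1$, and any $x_1,\dots,x_k\in X'$, there is a point $x\in X$ with $d(f^{p+a_j}x,f^px_j)<\epsilon$ for all $p=0,\dots,b_j-a_j$ and every $j=1,\dots,k$. Topological pressure of a (not necessarily compact or invariant) Borel set $Z\subset X$: let $B_n(x,\epsilon)=\{y\in X:d(f^i(x),f^i(y))<\epsilon\text{ for all }i=0,\dots,n-1\}$. For $\psi\in C(X)$, $\alpha\in\mathbb{R}$ and a finite or countable collection $\Gamma=\{B_{n_i}(x_i,\epsilon)\}_i$ put $$Q(Z,\alpha,\Gamma,\psi)=\sum_{B_{n_i}(x_i,\epsilon)\in\Gamma}\exp\Big(-\alpha n_i+\sup_{x\in B_{n_i}(x_i,\epsilon)}\sum_{k=0}^{n_i-1}\psi(f^k(x))\Big).$$ Let $M(Z,\alpha,\epsilon,N,\psi)=\inf_\Gamma Q(Z,\alpha,\Gamma,\psi)$, the infimum being over all finite or countable such collections $\Gamma$ with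 $x_i\in X$ that cover $Z$ and have $n_i\ge N$ for all $i$. Let $m(Z,\alpha,\epsilon,\psi)=\lim_{N\to\infty}M(Z,\alpha,\epsilon,N,\psi)$, $P_Z(\psi,\epsilon)=\inf\{\alpha:m(Z,\alpha,\epsilon,\psi)=0\}=\sup\{\alpha:m(Z,\alpha,\epsilon,\psi)=\infty\}$, and $P_Z(\psi)=\lim_{\epsilon\to0}P_Z(\psi,\epsilon)$. $P_X^{classic}(\psi)$ denotes the usual topological pressure of $\psi$ for the continuous map $f$ on the compact space $X$ (it agrees with $P_X(\psi)$). *)

theory Defs
  imports "HOL-Probability.Probability_Measure"
begin

text \<open>The compact metric space $X$ is a type of class \<open>metric_space\<close> whose universe is assumed to be
  compact. Entropies and pressures may be infinite and are \<open>ereal\<close>-valued; logarithms are natural.\<close>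

definition birkhoff_sum :: "('a \<Rightarrow> 'a) \<Rightarrow> ('a \<Rightarrow> real) \<Rightarrow> nat \<Rightarrow> 'a \<Rightarrow> real" where
  "birkhoff_sum f \<psi> n x = (\<Sum>k<n. \<psi> ((f ^^ k) x))"

definition irregular_set :: "('a \<Rightarrow> 'a) \<Rightarrow> ('a \<Rightarrow> real) \<Rightarrow> 'a set" where
  "irregular_set f \<phi> = {x. \<not> convergent (\<lambda>n. birkhoff_sum f \<phi> n x / real n)}"

definition invariant_measures :: "('a::metric_space \<Rightarrow> 'a) \<Rightarrow> 'a measure set" where
  "invariant_measures f = {\<mu>. sets \<mu> = sets borel \<and> prob_space \<mu> \<and> distr \<mu> \<mu> f = \<mu>}"

text \<open>A non-measurable set has \<open>emeasure\<close> zero, so membership below forces \<open>X'\<close> to be Borel.\<close>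

definition invariant_measures_on :: "('a::metric_space \<Rightarrow> 'a) \<Rightarrow> 'a set \<Rightarrow> 'a measure set" where
  "invariant_measures_on f X' = {\<mu> \<in> invariant_measures f. emeasure \<mu> X' = 1}"

definition partition_entropy :: "'a measure \<Rightarrow> 'a set set \<Rightarrow> real" where
  "partition_entropy \<mu> P = - (\<Sum>A\<in>P. measure \<mu> A * ln (measure \<mu> A))"

text \<open>The join of \<open>P, f\<inverse> P, \<dots>, f\<inverse>\<^sup>(\<^sup>n\<^sup>-\<^sup>1\<^sup>) P\<close>. It may contain the empty set, which contributes
  \<open>0 * ln 0 = 0\<close> to the entropy.\<close>

definition iterated_join :: "('a \<Rightarrow> 'a) \<Rightarrow> 'a set set \<Rightarrow> nat \<Rightarrow> 'a set set" where
  "iterated_join f P n = {(\<Inter>i<n. (f ^^ i) -` A i) | A. \<forall>i<n. A i \<in> P}"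

definition partition_dynamical_entropy :: "'a measure \<Rightarrow> ('a \<Rightarrow> 'a) \<Rightarrow> 'a set set \<Rightarrow> real" where
  "partition_dynamical_entropy \<mu> f P =
     lim (\<lambda>n. partition_entropy \<mu> (iterated_join f P n) / real n)"

definition measure_entropy :: "'a measure \<Rightarrow> ('a \<Rightarrow> 'a) \<Rightarrow> ereal" where
  "measure_entropy \<mu> f =
     (SUP P\<in>{P. finite P \<and> P \<subseteq> sets \<mu> \<and> partition_on (space \<mu>) P}.
        ereal (partition_dynamical_entropy \<mu> f P))"

definition specification_on :: "('a::metric_space \<Rightarrow> 'a) \<Rightarrow> 'a set \<Rightarrow> bool" where
  "specification_on f X' \<longleftrightarrow>
     (\<forall>\<epsilon>>0. \<exists>m::nat. \<forall>(k::nat) (a::nat \<Rightarrow> nat) (b::nat \<Rightarrow> nat) (x::nat \<Rightarrow> 'a).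
        (\<forall>j<k. a j \<le> b j \<and> x j \<in> X') \<longrightarrow>
        (\<forall>j. Suc j < k \<longrightarrow> b j + m \<le> a (Suc j)) \<longrightarrow>
        (\<exists>z. \<forall>j<k. \<forall>p\<le>b j - a j. dist ((f ^^ (p + a j)) z) ((f ^^ p) (x j)) < \<epsilon>))"

definition bowen_ball :: "('a::metric_space \<Rightarrow> 'a) \<Rightarrow> nat \<Rightarrow> 'a \<Rightarrow> real \<Rightarrow> 'a set" where
  "bowen_ball f n x \<epsilon> = {y. \<forall>i<n. dist ((f ^^ i) x) ((f ^^ i) y) < \<epsilon>}"

text \<open>A collection of Bowen balls of radius \<open>\<epsilon>\<close> is given by the set of its labels \<open>(n, x)\<close>, since
  the length \<open>n\<close> cannot be recovered from the ball as a set.\<close>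

definition cover_weight ::
  "('a::metric_space \<Rightarrow> 'a) \<Rightarrow> ('a \<Rightarrow> real) \<Rightarrow> real \<Rightarrow> real \<Rightarrow> (nat \<times> 'a) set \<Rightarrow> ennreal" where
  "cover_weight f \<psi> \<alpha> \<epsilon> \<Gamma> =
     (\<Sum>\<^sub>\<infinity>(n, x)\<in>\<Gamma>. ennreal (exp (- \<alpha> * real n + (SUP y\<in>bowen_ball f n x \<epsilon>. birkhoff_sum f \<psi> n y))))"

definition bowen_covers ::
  "('a::metric_space \<Rightarrow> 'a) \<Rightarrow> 'a set \<Rightarrow> real \<Rightarrow> nat \<Rightarrow> (nat \<times> 'a) set set" where
  "bowen_covers f Z \<epsilon> N =
     {\<Gamma>. countable \<Gamma> \<and> (\<forall>(n, x)\<in>\<Gamma>. N \<le> n) \<and> Z \<subseteq> (\<Union>(n, x)\<in>\<Gamma>. bowen_ball f n x \<epsilon>)}"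

definition pressure_outer_measure ::
  "('a::metric_space \<Rightarrow> 'a) \<Rightarrow> 'a set \<Rightarrow> real \<Rightarrow> real \<Rightarrow> ('a \<Rightarrow> real) \<Rightarrow> ennreal" where
  "pressure_outer_measure f Z \<alpha> \<epsilon> \<psi> =
     lim (\<lambda>N. INF \<Gamma>\<in>bowen_covers f Z \<epsilon> N. cover_weight f \<psi> \<alpha> \<epsilon> \<Gamma>)"

definition pressure_at_scale ::
  "('a::metric_space \<Rightarrow> 'a) \<Rightarrow> 'a set \<Rightarrow> ('a \<Rightarrow> real) \<Rightarrow> real \<Rightarrow> ereal" where
  "pressure_at_scale f Z \<psi> \<epsilon> = (INF \<alpha>\<in>{\<alpha>. pressure_outer_measure f Z \<alpha> \<epsilon> \<psi> = 0}. ereal \<alpha>)"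

definition topological_pressure ::
  "('a::metric_space \<Rightarrow> 'a) \<Rightarrow> 'a set \<Rightarrow> ('a \<Rightarrow> real) \<Rightarrow> ereal" where
  "topological_pressure f Z \<psi> = Lim (at_right 0) (pressure_at_scale f Z \<psi>)"

definition separated_sets :: "('a::metric_space \<Rightarrow> 'a) \<Rightarrow> nat \<Rightarrow> real \<Rightarrow> 'a set set" where
  "separated_sets f n \<epsilon> =
     {E. finite E \<and> (\<forall>x\<in>E. \<forall>y\<in>E. x \<noteq> y \<longrightarrow> (\<exists>i<n. dist ((f ^^ i) x) ((f ^^ i) y) > \<epsilon>))}"

text \<open>The usual pressure on a compact space, via \<open>(n, \<epsilon>)\<close>-separated sets (on a compact space the
  inner supremum is over a nonempty set bounded above).\<close>

definition classic_pressure :: "('a::metric_space \<Rightarrow> 'a) \<Rightarrow> ('a \<Rightarrow> real) \<Rightarrow> ereal" where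
  "classic_pressure f \<psi> =
     Lim (at_right 0) (\<lambda>\<epsilon>. limsup (\<lambda>n.
       ereal (ln (SUP E\<in>separated_sets f n \<epsilon>. \<Sum>x\<in>E. exp (birkhoff_sum f \<psi> n x)) / real n)))"

end

theory Submission
  imports Defs
begin

text \<open>
  Everything happens at one fixed scale \<open>\<epsilon>\<close>. Specification lets one concatenate, with gaps of length
  \<open>m = m(\<epsilon>)\<close>, orbit blocks of length \<open>n\<close> (with \<open>n\<close> much larger than \<open>m\<close>) of points of \<open>X'\<close>. Most blocks
  range over a maximal \<open>(n, 4\<epsilon>)\<close>-separated subset \<open>E\<close> of \<open>X'\<close>; on the sparse windows
  \<open>q 4\<^sup>k \<le> j < (q + 1) 4\<^sup>k\<close> of block indices, which carry a proportion of at most \<open>2/q\<close>, the block is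
  prescribed to be a fixed orbit piece whose \<open>\<phi>\<close>-average is high for even \<open>k\<close> and low for odd \<open>k\<close>.
  Since a window is a fixed proportion of the time elapsed, a convergent Birkhoff average would force
  the averages over the windows to converge as well, so every point shadowing such a concatenation is
  irregular. Giving independent blocks the weights \<open>exp (S\<^sub>n\<psi> e) / Z\<close> with \<open>Z = \<Sum>\<^sub>e exp (S\<^sub>n\<psi> e)\<close>, the mass
  of every Bowen ball is controlled deterministically, and compactness turns this into the lower bound
  \<open>ln Z / n\<close>, up to small errors, for the pressure of the irregular set.

  It remains to see \<open>ln Z \<ge> H\<^sub>\<mu>(P\<^sup>n) + n \<integral>\<psi> d\<mu> - n\<gamma>\<close>. Approximate the atoms of \<open>P\<close> from inside by compact
  sets. The itinerary of a point \<open>y\<close> can then be guessed from a nearby \<open>e \<in> E\<close>, except at the rare times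
  at which \<open>y\<close> visits the complement of these sets; this yields a subprobability on itineraries, to
  which Gibbs' inequality is applied. No ergodic theorem, ergodic decomposition or
  Shannon--McMillan--Breiman theorem is involved, as \<open>\<mu>\<close> only enters through integrals.
\<close>

section \<open>Scales and limits of pressures\<close>

text \<open>Pressures at scale \<open>\<epsilon>\<close> are monotone in \<open>\<epsilon>\<close> only up to the modulus of continuity of the potential,
  because the supremum over a Bowen ball grows with its radius.\<close>

lemma tendsto_Lim_at_right_quasi_mono:
  fixes g :: "real \<Rightarrow> ereal"
  assumes "\<And>v. v > 0 \<Longrightarrow> \<exists>d>0. \<forall>s t. 0 < s \<and> s \<le> t \<and> t < d \<longrightarrow> g t \<le> g s + ereal v"
  shows "(g \<longlongrightarrow> Lim (at_right 0) g) (at_right 0)"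
proof -
  have bd: "Limsup (at_right 0) g \<le> Liminf (at_right 0) g + ereal v" if v: "v > 0" for v
  proof -
    from assms[OF v] obtain d
      where d: "d > 0" "\<forall>s t. 0 < s \<and> s \<le> t \<and> t < d \<longrightarrow> g t \<le> g s + ereal v" by blast
    have "g t \<le> Liminf (at_right 0) g + ereal v" if t: "0 < t" "t < d" for t
    proof -
      have "eventually (\<lambda>s. g t - ereal v \<le> g s) (at_right 0)"
      proof (rule eventually_at_rightI[OF _ t(1)])
        fix s assume "s \<in> {0<..<t}"
        hence "g t \<le> g s + ereal v" using d(2)[rule_format, of s t] t by simp
        thus "g t - ereal v \<le> g s" by (subst ereal_minus_le) auto
      qed
      hence "g t - ereal v \<le> Liminf (at_right 0) g" by (rule Liminf_bounded)
      thus ?thesis by (subst (asm) ereal_minus_le) auto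
    qed
    hence "eventually (\<lambda>t. g t \<le> Liminf (at_right 0) g + ereal v) (at_right 0)"
      by (intro eventually_at_rightI[OF _ d(1)]) simp
    thus ?thesis by (rule Limsup_bounded)
  qed
  have "Limsup (at_right 0) g \<le> Liminf (at_right 0) g"
    by (rule ereal_le_epsilon2) (rule bd)
  hence "Liminf (at_right 0) g = Limsup (at_right 0) g"
    by (rule antisym[OF Liminf_le_Limsup[OF trivial_limit_at_right_real]])
  hence lim: "(g \<longlongrightarrow> Limsup (at_right 0) g) (at_right 0)"
    by (intro Liminf_eq_Limsup trivial_limit_at_right_real) auto
  have "Lim (at_right 0) g = Limsup (at_right 0) g"
    by (rule tendsto_Lim[OF trivial_limit_at_right_real lim])
  with lim show ?thesis by simp
qed

section \<open>Bowen balls and separated sets in a compact system\<close>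

locale compact_system =
  fixes f :: "'a::metric_space \<Rightarrow> 'a"
  assumes compact_UNIV: "compact (UNIV :: 'a set)"
    and cont: "continuous_on UNIV f"
begin

lemma continuous_funpow: "continuous_on UNIV (f ^^ i)"
proof (induction i)
  case 0
  show ?case by (simp only: funpow.simps id_def continuous_on_id)
next
  case (Suc i)
  show ?case unfolding funpow.simps o_def by (rule continuous_on_compose2[OF cont Suc subset_UNIV])
qed

lemma continuous_bounded:
  fixes \<psi> :: "'a \<Rightarrow> real"
  assumes "continuous_on UNIV \<psi>"
  obtains B where "B \<ge> 0" "\<And>x. \<bar>\<psi> x\<bar> \<le> B"
proof -
  have "bounded (range \<psi>)"
    by (rule compact_imp_bounded[OF compact_continuous_image[OF assms compact_UNIV]])
  then obtain B where B: "\<And>x. \<bar>\<psi> x\<bar> \<le> B" unfolding bounded_iff by auto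
  show ?thesis
    by (rule that[OF order_trans[OF abs_ge_zero B[of undefined]] B])
qed

lemma uniform_modulus:
  fixes \<psi> :: "'a \<Rightarrow> real"
  assumes "continuous_on UNIV \<psi>" "e > 0"
  obtains d where "d > 0" "\<And>x y. dist x y \<le> d \<Longrightarrow> \<bar>\<psi> x - \<psi> y\<bar> \<le> e"
proof -
  have "uniformly_continuous_on UNIV \<psi>" using compact_uniformly_continuous[OF assms(1) compact_UNIV] .
  from uniformly_continuous_onE[OF this assms(2)]
  obtain d where d: "d > 0" "\<And>x y. dist x y < d \<Longrightarrow> dist (\<psi> y) (\<psi> x) < e"
    by (auto simp: dist_commute)
  show ?thesis
  proof (rule that)
    \<comment> \<open>Halving the modulus makes the condition \<open>dist x y \<le> d\<close>
      non-strict. This is the form available for maximal separated sets and for points of the closed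
      shadowing sets.\<close>
    show "d / 2 > 0" using d(1) by simp
    fix x y :: 'a assume "dist x y \<le> d / 2"
    hence "dist (\<psi> y) (\<psi> x) < e" using d(1) by (intro d(2)) simp
    thus "\<bar>\<psi> x - \<psi> y\<bar> \<le> e" by (simp add: dist_real_def)
  qed
qed

lemma open_bowen_ball: "open (bowen_ball f n x \<epsilon>)"
proof -
  have "bowen_ball f n x \<epsilon> = (\<Inter>i<n. (f ^^ i) -` ball ((f ^^ i) x) \<epsilon>)"
    by (auto simp: bowen_ball_def)
  moreover have "open ((f ^^ i) -` ball ((f ^^ i) x) \<epsilon>)" for i
    by (intro open_vimage continuous_funpow) auto
  ultimately show ?thesis by auto
qed

text \<open>Pigeonhole: finitely many Bowen balls of radius \<open>\<epsilon>/2\<close> cover the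
  compact space, and by the triangle inequality each contains at most one point of a separated
  set.\<close>

lemma separated_sets_card_bound:
  assumes "\<epsilon> > 0"
  obtains C where "\<And>E. E \<in> separated_sets f n \<epsilon> \<Longrightarrow> card E \<le> C"
proof -
  have cov: "UNIV \<subseteq> (\<Union>x\<in>UNIV. bowen_ball f n x (\<epsilon>/2))"
  proof
    fix x :: 'a
    have "x \<in> bowen_ball f n x (\<epsilon>/2)" using assms by (simp add: bowen_ball_def)
    thus "x \<in> (\<Union>x\<in>UNIV. bowen_ball f n x (\<epsilon>/2))" by blast
  qed
  obtain F where F: "finite F" "UNIV \<subseteq> (\<Union>x\<in>F. bowen_ball f n x (\<epsilon>/2))"
    by (rule compactE_image[OF compact_UNIV _ cov]) (auto simp: open_bowen_ball)
  have "card E \<le> card F" if E: "E \<in> separated_sets f n \<epsilon>" for E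
  proof -
    have "\<forall>y. \<exists>x\<in>F. y \<in> bowen_ball f n x (\<epsilon>/2)" using F(2) by auto
    then obtain c where c: "\<And>y. c y \<in> F" "\<And>y. y \<in> bowen_ball f n (c y) (\<epsilon>/2)" by metis
    have "inj_on c E"
    proof (rule inj_onI, rule ccontr)
      fix x y assume xy: "x \<in> E" "y \<in> E" "c x = c y" "x \<noteq> y"
      then obtain i where i: "i < n" "dist ((f ^^ i) x) ((f ^^ i) y) > \<epsilon>"
        using E by (auto simp: separated_sets_def)
      have "dist ((f ^^ i) (c x)) ((f ^^ i) x) < \<epsilon>/2" "dist ((f ^^ i) (c x)) ((f ^^ i) y) < \<epsilon>/2"
        using c(2)[of x] c(2)[of y] xy(3) i(1) by (auto simp: bowen_ball_def)
      hence "dist ((f ^^ i) x) ((f ^^ i) y) < \<epsilon>" by (rule dist_triangle_half_r)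
      thus False using i(2) by simp
    qed
    thus ?thesis using c(1) F(1) by (intro card_inj_on_le) auto
  qed
  thus ?thesis using that by blast
qed

text \<open>Cardinalities of separated subsets of \<open>S\<close> are bounded, so one of them is
  largest; a point of \<open>S\<close> far from all its members could be added to it.
  \<open>S\<close> may be any set, closed or not, so the lemma applies to \<open>X'\<close>.\<close>

lemma maximal_separated_set:
  assumes "\<epsilon> > 0"
  obtains E where "E \<in> separated_sets f n \<epsilon>" "E \<subseteq> S"
    "\<And>y. y \<in> S \<Longrightarrow> \<exists>e\<in>E. \<forall>i<n. dist ((f ^^ i) e) ((f ^^ i) y) \<le> \<epsilon>"
proof -
  obtain C where C: "\<And>E. E \<in> separated_sets f n \<epsilon> \<Longrightarrow> card E \<le> C"
    using separated_sets_card_bound[OF assms] by blast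
  let ?P = "\<lambda>E. E \<in> separated_sets f n \<epsilon> \<and> E \<subseteq> S"
  have "?P {}" by (auto simp: separated_sets_def)
  then obtain E where E: "?P E" "\<And>E'. ?P E' \<Longrightarrow> card E' \<le> card E"
  proof -
    have "\<exists>E. ?P E \<and> (\<forall>E'. ?P E' \<longrightarrow> card E' \<le> card E)"
      by (rule ex_has_greatest_nat[of ?P "{}" card "Suc C"])
        (use \<open>?P {}\<close> C in \<open>auto simp: less_Suc_eq_le\<close>)
    thus ?thesis using that by blast
  qed
  have "\<exists>e\<in>E. \<forall>i<n. dist ((f ^^ i) e) ((f ^^ i) y) \<le> \<epsilon>" if y: "y \<in> S" for y
  proof (rule ccontr)
    assume "\<not> ?thesis"
    hence *: "\<forall>e\<in>E. \<exists>i<n. dist ((f ^^ i) e) ((f ^^ i) y) > \<epsilon>" by (auto simp: not_le)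
    have fin: "finite E" using E(1) by (auto simp: separated_sets_def)
    show False
    proof (cases "y \<in> E")
      case True
      thus ?thesis using * assms by fastforce
    next
      case False
      have "?P (insert y E)" using E(1) y *
        by (auto simp: separated_sets_def dist_commute)
      from E(2)[OF this] show False using False fin by simp
    qed
  qed
  thus ?thesis using that E by blast
qed

text \<open>Raising \<open>N\<close> leaves fewer admissible covers, so the infima increase and the
  \<open>lim\<close> of the definition is their supremum, which vanishes exactly if all of them
  do.\<close>

lemma pressure_outer_measure_eq_0_iff:
  "pressure_outer_measure f Z \<alpha> \<epsilon> \<psi> = 0 \<longleftrightarrow>
     (\<forall>N. (INF \<Gamma>\<in>bowen_covers f Z \<epsilon> N. cover_weight f \<psi> \<alpha> \<epsilon> \<Gamma>) = 0)"
proof -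
  let ?M = "\<lambda>N. INF \<Gamma>\<in>bowen_covers f Z \<epsilon> N. cover_weight f \<psi> \<alpha> \<epsilon> \<Gamma>"
  have "incseq ?M"
    by (intro incseq_SucI INF_superset_mono) (fastforce simp: bowen_covers_def)+
  hence "?M \<longlonglongrightarrow> (SUP N. ?M N)" by (rule LIMSEQ_SUP)
  hence eq: "pressure_outer_measure f Z \<alpha> \<epsilon> \<psi> = (SUP N. ?M N)"
    unfolding pressure_outer_measure_def by (rule limI)
  have "(SUP N. ?M N) \<le> 0 \<longleftrightarrow> (\<forall>N. ?M N \<le> 0)" by (subst SUP_le_iff) blast
  thus ?thesis unfolding eq by simp
qed

end

section \<open>Birkhoff sums, and both pressures as genuine limits over the scale\<close>

lemma abs_birkhoff_sum_le:
  assumes "\<And>x. \<bar>\<psi> x\<bar> \<le> B"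
  shows "\<bar>birkhoff_sum f \<psi> n x\<bar> \<le> real n * B"
proof -
  have "\<bar>birkhoff_sum f \<psi> n x\<bar> \<le> (\<Sum>i<n. \<bar>\<psi> ((f ^^ i) x)\<bar>)"
    unfolding birkhoff_sum_def by (rule sum_abs)
  also have "\<dots> \<le> of_nat (card {..<n}) * B" by (rule sum_bounded_above) (use assms in auto)
  finally show ?thesis by simp
qed

lemma birkhoff_sum_diff_le:
  assumes "\<And>i. i < n \<Longrightarrow> \<bar>\<psi> ((f ^^ i) x) - \<psi> ((f ^^ i) y)\<bar> \<le> v"
  shows "\<bar>birkhoff_sum f \<psi> n x - birkhoff_sum f \<psi> n y\<bar> \<le> real n * v"
proof -
  have "\<bar>birkhoff_sum f \<psi> n x - birkhoff_sum f \<psi> n y\<bar> \<le> (\<Sum>i<n. \<bar>\<psi> ((f ^^ i) x) - \<psi> ((f ^^ i) y)\<bar>)"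
    unfolding birkhoff_sum_def sum_subtractf[symmetric] by (rule sum_abs)
  also have "\<dots> \<le> of_nat (card {..<n}) * v" by (rule sum_bounded_above) (use assms in auto)
  finally show ?thesis by simp
qed

lemma bdd_above_birkhoff_sum:
  assumes "\<And>x. \<bar>\<psi> x\<bar> \<le> B"
  shows "bdd_above (birkhoff_sum f \<psi> n ` S)"
  using abs_birkhoff_sum_le[of \<psi> B f n, OF assms] by (intro bdd_aboveI2[of _ _ "real n * B"]) (auto simp: abs_le_iff)

context compact_system begin

text \<open>The labels of a cover at scale \<open>s\<close> also give a cover at the larger scale
  \<open>t\<close>. Comparing with the centre of the ball, the supremum of the Birkhoff sum grows by
  at most \<open>n * v\<close>, which is absorbed by replacing \<open>\<alpha>\<close> with
  \<open>\<alpha> + v\<close>.\<close>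

lemma pressure_at_scale_quasi_mono:
  assumes \<psi>: "continuous_on UNIV \<psi>" and st: "0 < s" "s \<le> t"
    and v: "\<And>x y. dist x y \<le> t \<Longrightarrow> \<bar>\<psi> x - \<psi> y\<bar> \<le> v"
  shows "pressure_at_scale f Z \<psi> t \<le> pressure_at_scale f Z \<psi> s + ereal v"
proof -
  obtain B where "B \<ge> 0" and B: "\<And>x. \<bar>\<psi> x\<bar> \<le> B" using continuous_bounded[OF \<psi>] by blast
  have sup: "(SUP y\<in>bowen_ball f n x t. birkhoff_sum f \<psi> n y)
      \<le> (SUP y\<in>bowen_ball f n x s. birkhoff_sum f \<psi> n y) + real n * v" for n x
  proof (rule cSUP_least)
    have mem: "x \<in> bowen_ball f n x s" using st by (auto simp: bowen_ball_def)
    have "x \<in> bowen_ball f n x t" using st by (auto simp: bowen_ball_def)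
    thus "bowen_ball f n x t \<noteq> {}" by blast
    fix y assume y: "y \<in> bowen_ball f n x t"
    have "\<bar>birkhoff_sum f \<psi> n x - birkhoff_sum f \<psi> n y\<bar> \<le> real n * v"
      using y by (intro birkhoff_sum_diff_le v) (auto simp: bowen_ball_def intro: less_imp_le)
    moreover have "birkhoff_sum f \<psi> n x \<le> (SUP y\<in>bowen_ball f n x s. birkhoff_sum f \<psi> n y)"
      by (intro cSUP_upper mem bdd_above_birkhoff_sum[OF B])
    ultimately show "birkhoff_sum f \<psi> n y \<le> (SUP y\<in>bowen_ball f n x s. birkhoff_sum f \<psi> n y) + real n * v"
      by linarith
  qed
  have w: "cover_weight f \<psi> (\<alpha> + v) t \<Gamma> \<le> cover_weight f \<psi> \<alpha> s \<Gamma>" for \<alpha> \<Gamma>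
    unfolding cover_weight_def
  proof (rule infsum_mono)
    show "(case i of (n, x) \<Rightarrow> ennreal (exp (- (\<alpha> + v) * real n + (SUP y\<in>bowen_ball f n x t. birkhoff_sum f \<psi> n y))))
      \<le> (case i of (n, x) \<Rightarrow> ennreal (exp (- \<alpha> * real n + (SUP y\<in>bowen_ball f n x s. birkhoff_sum f \<psi> n y))))" for i
      using sup[of "fst i" "snd i"] by (auto simp: case_prod_unfold algebra_simps intro!: ennreal_leI)
  qed (intro nonneg_summable_on_complete zero_le)+
  have "bowen_ball f n x s \<subseteq> bowen_ball f n x t" for n x
    using st by (force simp: bowen_ball_def)
  hence c: "bowen_covers f Z s N \<subseteq> bowen_covers f Z t N" for N
    unfolding bowen_covers_def by blast
  have "pressure_outer_measure f Z (\<alpha> + v) t \<psi> = 0" if "pressure_outer_measure f Z \<alpha> s \<psi> = 0" for \<alpha>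
  proof -
    have "(INF \<Gamma>\<in>bowen_covers f Z t N. cover_weight f \<psi> (\<alpha> + v) t \<Gamma>)
        \<le> (INF \<Gamma>\<in>bowen_covers f Z s N. cover_weight f \<psi> \<alpha> s \<Gamma>)" for N
      by (intro INF_superset_mono c w)
    with that show ?thesis unfolding pressure_outer_measure_eq_0_iff by (metis le_zero_eq)
  qed
  hence le: "pressure_at_scale f Z \<psi> t - ereal v \<le> ereal \<alpha>"
    if "pressure_outer_measure f Z \<alpha> s \<psi> = 0" for \<alpha>
    using INF_lower[of "\<alpha> + v" "{\<alpha>. pressure_outer_measure f Z \<alpha> t \<psi> = 0}" ereal] that
    by (simp add: pressure_at_scale_def ereal_minus_le)
  have "pressure_at_scale f Z \<psi> t - ereal v \<le> pressure_at_scale f Z \<psi> s"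
    unfolding pressure_at_scale_def[of _ _ _ s] by (rule INF_greatest) (use le in simp)
  thus ?thesis by (simp add: ereal_minus_le)
qed

lemma pressure_at_scale_tendsto:
  assumes "continuous_on UNIV \<psi>"
  shows "(pressure_at_scale f Z \<psi> \<longlongrightarrow> topological_pressure f Z \<psi>) (at_right 0)"
  unfolding topological_pressure_def
proof (rule tendsto_Lim_at_right_quasi_mono)
  fix v :: real assume "v > 0"
  obtain d where d: "d > 0" "\<And>x y. dist x y \<le> d \<Longrightarrow> \<bar>\<psi> x - \<psi> y\<bar> \<le> v"
    using uniform_modulus[OF assms \<open>v > 0\<close>] by blast
  show "\<exists>d>0. \<forall>s t. 0 < s \<and> s \<le> t \<and> t < d \<longrightarrow>
      pressure_at_scale f Z \<psi> t \<le> pressure_at_scale f Z \<psi> s + ereal v"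
  proof (intro exI[of _ d] conjI allI impI)
    fix s t :: real assume st: "0 < s \<and> s \<le> t \<and> t < d"
    show "pressure_at_scale f Z \<psi> t \<le> pressure_at_scale f Z \<psi> s + ereal v"
      by (rule pressure_at_scale_quasi_mono[OF assms]) (use st in \<open>auto intro: d(2)\<close>)
  qed (rule d(1))
qed

lemma bdd_above_separated_sum:
  assumes \<psi>: "continuous_on UNIV \<psi>" and "\<epsilon> > 0"
  shows "bdd_above ((\<lambda>E. \<Sum>x\<in>E. exp (birkhoff_sum f \<psi> n x)) ` separated_sets f n \<epsilon>)"
proof -
  obtain B where "B \<ge> 0" and B: "\<And>x. \<bar>\<psi> x\<bar> \<le> B" using continuous_bounded[OF \<psi>] by blast
  obtain C where C: "\<And>E. E \<in> separated_sets f n \<epsilon> \<Longrightarrow> card E \<le> C"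
    using separated_sets_card_bound[OF assms(2)] by blast
  have "(\<Sum>x\<in>E. exp (birkhoff_sum f \<psi> n x)) \<le> real C * exp (real n * B)"
    if "E \<in> separated_sets f n \<epsilon>" for E
  proof -
    have "(\<Sum>x\<in>E. exp (birkhoff_sum f \<psi> n x)) \<le> real (card E) * exp (real n * B)"
      using abs_birkhoff_sum_le[of \<psi> B f n, OF B]
      by (intro sum_bounded_above) (auto simp: abs_le_iff)
    also have "\<dots> \<le> real C * exp (real n * B)" using C[OF that] by (intro mult_right_mono) auto
    finally show ?thesis .
  qed
  thus ?thesis by (rule bdd_aboveI2)
qed

text \<open>Separation at scale \<open>t\<close> implies separation at any smaller scale
  \<open>s\<close>, so the growth rates are truly monotone in the scale and the quasi-monotone
  criterion holds with any tolerance.\<close>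

lemma classic_pressure_tendsto:
  assumes \<psi>: "continuous_on UNIV \<psi>"
  shows "((\<lambda>\<epsilon>. limsup (\<lambda>n. ereal (ln (SUP E\<in>separated_sets f n \<epsilon>. \<Sum>x\<in>E. exp (birkhoff_sum f \<psi> n x)) / real n)))
     \<longlongrightarrow> classic_pressure f \<psi>) (at_right 0)"
  unfolding classic_pressure_def
proof (rule tendsto_Lim_at_right_quasi_mono, intro exI[of _ 1] conjI allI impI)
  fix v s t :: real assume v: "v > 0" and st: "0 < s \<and> s \<le> t \<and> t < 1"
  let ?S = "\<lambda>n \<epsilon>. SUP E\<in>separated_sets f n \<epsilon>. \<Sum>x\<in>E. exp (birkhoff_sum f \<psi> n x)"
  have "ln (?S n t) / real n \<le> ln (?S n s) / real n" for n
  proof -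
    have sub: "separated_sets f n t \<subseteq> separated_sets f n s"
    proof
      fix E assume E: "E \<in> separated_sets f n t"
      have "\<exists>i<n. s < dist ((f ^^ i) x) ((f ^^ i) y)" if xy: "x \<in> E" "y \<in> E" "x \<noteq> y" for x y
      proof -
        obtain i where "i < n" "t < dist ((f ^^ i) x) ((f ^^ i) y)"
          using E xy unfolding separated_sets_def by blast
        thus ?thesis using st by (intro exI[of _ i]) auto
      qed
      thus "E \<in> separated_sets f n s" using E unfolding separated_sets_def by blast
    qed
    have sing: "{x} \<in> separated_sets f n t" for x by (auto simp: separated_sets_def)
    have bdd: "bdd_above ((\<lambda>E. \<Sum>x\<in>E. exp (birkhoff_sum f \<psi> n x)) ` separated_sets f n r)" if "r > 0" for r
      by (rule bdd_above_separated_sum[OF \<psi> that])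
    have "0 < t" using st by linarith
    have "?S n t \<le> ?S n s"
    proof (rule cSUP_subset_mono[OF _ bdd[OF conjunct1[OF st]] sub order_refl])
      show "separated_sets f n t \<noteq> {}" using sing by blast
    qed
    \<comment> \<open>A singleton is always separated, so the supremum is positive and
      \<open>ln\<close> is monotone there.\<close>
    moreover have "0 < (\<Sum>x\<in>{undefined}. exp (birkhoff_sum f \<psi> n x))" by simp
    moreover have "(\<Sum>x\<in>{undefined}. exp (birkhoff_sum f \<psi> n x)) \<le> ?S n t"
      by (rule cSUP_upper[OF sing bdd[OF \<open>0 < t\<close>]])
    ultimately have "ln (?S n t) \<le> ln (?S n s)" by (intro ln_mono) linarith+
    thus ?thesis by (rule divide_right_mono) simp
  qed
  hence "limsup (\<lambda>n. ereal (ln (?S n t) / real n)) \<le> limsup (\<lambda>n. ereal (ln (?S n s) / real n))"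
    by (intro Limsup_mono) simp
  from add_mono[OF this, of 0 "ereal v"] v
  show "limsup (\<lambda>n. ereal (ln (?S n t) / real n)) \<le> limsup (\<lambda>n. ereal (ln (?S n s) / real n)) + ereal v"
    by simp
qed simp

text \<open>A maximal separated set of the whole space, used with a single large length
  \<open>n\<close>, gives a cover of every \<open>Z\<close>. Maximality only yields distances
  \<open>\<le> \<epsilon>\<close> whereas Bowen balls are open, hence the radius
  \<open>2 * \<epsilon>\<close>.\<close>

lemma pressure_at_scale_le_separated:
  assumes \<psi>: "continuous_on UNIV \<psi>" and \<epsilon>: "\<epsilon> > 0" "v \<ge> 0"
    and v: "\<And>x y. dist x y \<le> 2 * \<epsilon> \<Longrightarrow> \<bar>\<psi> x - \<psi> y\<bar> \<le> v"
  shows "pressure_at_scale f Z \<psi> (2 * \<epsilon>) \<le>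
    limsup (\<lambda>n. ereal (ln (SUP E\<in>separated_sets f n \<epsilon>. \<Sum>x\<in>E. exp (birkhoff_sum f \<psi> n x)) / real n)) + ereal v"
    (is "_ \<le> limsup ?c + _")
proof -
  let ?S = "\<lambda>n. SUP E\<in>separated_sets f n \<epsilon>. \<Sum>x\<in>E. exp (birkhoff_sum f \<psi> n x)"
  have "pressure_at_scale f Z \<psi> (2 * \<epsilon>) - ereal v \<le> limsup ?c"
  \<comment> \<open>Testing against real upper bounds \<open>\<beta>\<close> of the limsup takes
    care of infinite values.\<close>
  proof (rule ereal_le_real)
    fix \<beta> assume "limsup ?c \<le> ereal \<beta>"
    have main: "pressure_at_scale f Z \<psi> (2 * \<epsilon>) \<le> ereal (\<beta> + v) + ereal \<delta>" if \<delta>: "\<delta> > 0" for \<delta>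
    proof -
      \<comment> \<open>\<open>v\<close> pays for the oscillation of \<open>\<psi>\<close> on the
        balls and half of \<open>\<delta>\<close> for the slack in the limsup; the other half makes
        the cover weight decay like \<open>exp (- (\<delta>/2) * n)\<close>.\<close>
      define \<alpha> where "\<alpha> = \<beta> + v + \<delta>"
      have "limsup ?c < ereal (\<beta> + \<delta>/2)"
        using \<open>limsup ?c \<le> ereal \<beta>\<close> by (rule le_less_trans) (use \<delta> in simp)
      hence "eventually (\<lambda>n. ?c n < ereal (\<beta> + \<delta>/2)) sequentially"
        by (rule Limsup_lessD)
      then obtain N0 where N0: "\<And>n. n \<ge> N0 \<Longrightarrow> ln (?S n) / real n < \<beta> + \<delta>/2"
        unfolding eventually_sequentially by auto
      have zero: "(INF \<Gamma>\<in>bowen_covers f Z (2*\<epsilon>) N. cover_weight f \<psi> \<alpha> (2*\<epsilon>) \<Gamma>) \<le> ennreal \<eta>"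
        if \<eta>: "\<eta> > 0" for \<eta> N
      proof -
        have "(\<lambda>n. exp (- (\<delta>/2) * real n)) \<longlonglongrightarrow> 0"
          using \<delta> by (intro filterlim_compose[OF exp_at_bot] filterlim_tendsto_neg_mult_at_bot[OF tendsto_const _ filterlim_real_sequentially]) auto
        hence "eventually (\<lambda>n. exp (- (\<delta>/2) * real n) < \<eta>) sequentially"
          by (rule order_tendstoD(2)[OF _ \<eta>])
        \<comment> \<open>\<open>n \<ge> 1\<close> is required to clear the denominator
          \<open>real n\<close> below, as division by zero gives 0.\<close>
        hence "eventually (\<lambda>n. exp (- (\<delta>/2) * real n) < \<eta> \<and> n \<ge> max 1 (max N N0)) sequentially"
          by (intro eventually_conj eventually_ge_at_top)
        from eventually_happens'[OF sequentially_bot this]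
        obtain n where n: "exp (- (\<delta>/2) * real n) < \<eta>" "n \<ge> 1" "n \<ge> N" "n \<ge> N0" by auto
        obtain E where E: "E \<in> separated_sets f n \<epsilon>"
          "\<And>y. \<exists>e\<in>E. \<forall>i<n. dist ((f ^^ i) e) ((f ^^ i) y) \<le> \<epsilon>"
          using maximal_separated_set[OF \<epsilon>(1), of n UNIV] by auto
        have fin: "finite E" using E(1) by (auto simp: separated_sets_def)
        have Epos: "0 < (\<Sum>x\<in>E. exp (birkhoff_sum f \<psi> n x))"
          using E(2) fin by (intro sum_pos) auto
        have ES: "(\<Sum>x\<in>E. exp (birkhoff_sum f \<psi> n x)) \<le> ?S n"
          using E(1) by (intro cSUP_upper bdd_above_separated_sum[OF \<psi> \<epsilon>(1)])
        have "ln (?S n) < (\<beta> + \<delta>/2) * real n"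
          using N0[OF n(4)] n(2) by (simp add: field_simps)
        hence "exp (ln (?S n)) < exp ((\<beta> + \<delta>/2) * real n)" by (rule exp_less_mono)
        moreover have "exp (ln (?S n)) = ?S n" using Epos ES by (intro exp_ln) (rule less_le_trans)
        ultimately have Sn: "?S n < exp ((\<beta> + \<delta>/2) * real n)" by (simp only:)
        let ?\<Gamma> = "(\<lambda>x. (n, x)) ` E"
        have cov: "?\<Gamma> \<in> bowen_covers f Z (2*\<epsilon>) N"
        proof -
          have "\<exists>e\<in>E. y \<in> bowen_ball f n e (2*\<epsilon>)" for y
          proof -
            obtain e where "e \<in> E" "\<forall>i<n. dist ((f ^^ i) e) ((f ^^ i) y) \<le> \<epsilon>" using E(2) by blast
            thus ?thesis using \<epsilon> by (intro bexI[of _ e]) (auto simp: bowen_ball_def intro: le_less_trans)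
          qed
          thus ?thesis using n(3) fin by (auto simp: bowen_covers_def intro: countable_finite)
        qed
        have sup: "(SUP y\<in>bowen_ball f n x (2*\<epsilon>). birkhoff_sum f \<psi> n y) \<le> birkhoff_sum f \<psi> n x + real n * v" for x
        proof (rule cSUP_least)
          have "x \<in> bowen_ball f n x (2*\<epsilon>)" using \<epsilon> by (auto simp: bowen_ball_def)
          thus "bowen_ball f n x (2*\<epsilon>) \<noteq> {}" by blast
          fix y assume y: "y \<in> bowen_ball f n x (2*\<epsilon>)"
          have "\<bar>birkhoff_sum f \<psi> n x - birkhoff_sum f \<psi> n y\<bar> \<le> real n * v"
            using y by (intro birkhoff_sum_diff_le v) (auto simp: bowen_ball_def intro: less_imp_le)
          thus "birkhoff_sum f \<psi> n y \<le> birkhoff_sum f \<psi> n x + real n * v" by linarith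
        qed
        have "cover_weight f \<psi> \<alpha> (2*\<epsilon>) ?\<Gamma> =
           (\<Sum>x\<in>E. ennreal (exp (- \<alpha> * real n + (SUP y\<in>bowen_ball f n x (2*\<epsilon>). birkhoff_sum f \<psi> n y))))"
          unfolding cover_weight_def using fin by (simp add: sum.reindex inj_on_def)
        also have "\<dots> \<le> (\<Sum>x\<in>E. ennreal (exp (- (\<alpha> - v) * real n) * exp (birkhoff_sum f \<psi> n x)))"
        proof (intro sum_mono ennreal_leI)
          fix x
          show "exp (- \<alpha> * real n + (SUP y\<in>bowen_ball f n x (2*\<epsilon>). birkhoff_sum f \<psi> n y))
             \<le> exp (- (\<alpha> - v) * real n) * exp (birkhoff_sum f \<psi> n x)"
            unfolding exp_add[symmetric] using sup[of x] by (simp add: algebra_simps)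
        qed
        also have "\<dots> = ennreal (exp (- (\<alpha> - v) * real n) * (\<Sum>x\<in>E. exp (birkhoff_sum f \<psi> n x)))"
          by (subst sum_ennreal) (auto simp: sum_distrib_left)
        also have "\<dots> \<le> ennreal (exp (- (\<alpha> - v) * real n) * exp ((\<beta> + \<delta>/2) * real n))"
          by (intro ennreal_leI mult_left_mono order_trans[OF ES less_imp_le[OF Sn]]) simp
        also have "exp (- (\<alpha> - v) * real n) * exp ((\<beta> + \<delta>/2) * real n) = exp (- (\<delta>/2) * real n)"
          unfolding exp_add[symmetric] \<alpha>_def by (simp add: algebra_simps)
        also have "ennreal \<dots> \<le> ennreal \<eta>" using n(1) by (intro ennreal_leI) simp
        finally show ?thesis using cov by (intro INF_lower2)
      qed
      have "(INF \<Gamma>\<in>bowen_covers f Z (2*\<epsilon>) N. cover_weight f \<psi> \<alpha> (2*\<epsilon>) \<Gamma>) = 0" for N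
      proof -
        have "(INF \<Gamma>\<in>bowen_covers f Z (2*\<epsilon>) N. cover_weight f \<psi> \<alpha> (2*\<epsilon>) \<Gamma>) \<le> 0"
          by (rule ennreal_le_epsilon) (use zero in simp)
        thus ?thesis by simp
      qed
      hence "pressure_at_scale f Z \<psi> (2*\<epsilon>) \<le> ereal \<alpha>"
        unfolding pressure_at_scale_def
        by (intro INF_lower) (simp add: pressure_outer_measure_eq_0_iff)
      thus ?thesis by (simp add: \<alpha>_def)
    qed
    have "pressure_at_scale f Z \<psi> (2 * \<epsilon>) \<le> ereal (\<beta> + v)"
      by (rule ereal_le_epsilon2) (use main in auto)
    thus "pressure_at_scale f Z \<psi> (2 * \<epsilon>) - ereal v \<le> ereal \<beta>" by (simp add: ereal_minus_le)
  qed
  thus ?thesis by (simp add: ereal_minus_le)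
qed

text \<open>The scale \<open>2 * \<epsilon>\<close> tends to 0 together with
  \<open>\<epsilon>\<close>, so the previous estimate passes to the limit with the fixed error
  \<open>v\<close>, which is arbitrary.\<close>

lemma topological_pressure_le_classic:
  assumes \<psi>: "continuous_on UNIV \<psi>"
  shows "topological_pressure f Z \<psi> \<le> classic_pressure f \<psi>"
proof (rule ereal_le_epsilon2)
  fix v :: real assume v: "v > 0"
  obtain d where d: "d > 0" "\<And>x y. dist x y \<le> d \<Longrightarrow> \<bar>\<psi> x - \<psi> y\<bar> \<le> v"
    using uniform_modulus[OF assms v] by blast
  let ?c = "\<lambda>\<epsilon>. limsup (\<lambda>n. ereal (ln (SUP E\<in>separated_sets f n \<epsilon>. \<Sum>x\<in>E. exp (birkhoff_sum f \<psi> n x)) / real n))"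
  have lim: "filterlim (\<lambda>\<epsilon>::real. 2 * \<epsilon>) (at_right 0) (at_right 0)"
    unfolding filterlim_at
  proof
    show "eventually (\<lambda>\<epsilon>::real. 2 * \<epsilon> \<in> {0<..} \<and> 2 * \<epsilon> \<noteq> 0) (at_right 0)"
      by (rule eventually_at_rightI[of 0 1]) auto
    show "((\<lambda>\<epsilon>::real. 2 * \<epsilon>) \<longlongrightarrow> 0) (at_right 0)" by (auto intro!: tendsto_eq_intros)
  qed
  have l1: "((\<lambda>\<epsilon>. pressure_at_scale f Z \<psi> (2*\<epsilon>)) \<longlongrightarrow> topological_pressure f Z \<psi>) (at_right 0)"
    by (rule filterlim_compose[OF pressure_at_scale_tendsto[OF \<psi>] lim])
  have l2: "((\<lambda>\<epsilon>. ?c \<epsilon> + ereal v) \<longlongrightarrow> classic_pressure f \<psi> + ereal v) (at_right 0)"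
    by (intro tendsto_add_ereal_general1 classic_pressure_tendsto[OF \<psi>] tendsto_const) auto
  have l3: "eventually (\<lambda>\<epsilon>. pressure_at_scale f Z \<psi> (2*\<epsilon>) \<le> ?c \<epsilon> + ereal v) (at_right 0)"
  proof (rule eventually_at_rightI)
    show "0 < d/2" using d(1) by simp
    fix \<epsilon> assume "\<epsilon> \<in> {0<..<d/2}"
    thus "pressure_at_scale f Z \<psi> (2*\<epsilon>) \<le> ?c \<epsilon> + ereal v"
      by (intro pressure_at_scale_le_separated[OF \<psi>] d(2)) (use v in auto)
  qed
  show "topological_pressure f Z \<psi> \<le> classic_pressure f \<psi> + ereal v"
    by (rule tendsto_le[OF trivial_limit_at_right_real l2 l1 l3])
qed

end

section \<open>A Moran construction\<close>

lemma birkhoff_sum_add: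
  "birkhoff_sum f \<psi> (a + b) x = birkhoff_sum f \<psi> a x + birkhoff_sum f \<psi> b ((f ^^ a) x)"
proof (induction b)
  case (Suc b)
  have "(f ^^ (a + b)) x = (f ^^ b) ((f ^^ a) x)"
    by (metis add.commute funpow_add o_apply)
  with Suc show ?case by (simp add: birkhoff_sum_def)
qed (simp add: birkhoff_sum_def)

text \<open>Induction on the number of blocks: each shadowed block of length \<open>n\<close>
  contributes an error of at most \<open>n * v\<close>, and each gap of length \<open>m\<close>,
  where nothing is known about the orbit, at most \<open>m * B\<close>.\<close>

lemma birkhoff_sum_shadow:
  assumes B: "\<And>x. \<bar>\<psi> x\<bar> \<le> B"
    and sh: "\<And>j p. j < r \<Longrightarrow> p < n \<Longrightarrow> \<bar>\<psi> ((f ^^ (p + j * (n + m))) z) - \<psi> ((f ^^ p) (\<omega> j))\<bar> \<le> v"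
  shows "\<bar>birkhoff_sum f \<psi> (r * (n + m)) z - (\<Sum>j<r. birkhoff_sum f \<psi> n (\<omega> j))\<bar>
    \<le> real r * (real n * v + real m * B)"
  using sh
proof (induction r)
  case (Suc r)
  let ?y = "(f ^^ (r * (n + m))) z"
  have 1: "\<bar>birkhoff_sum f \<psi> (r * (n + m)) z - (\<Sum>j<r. birkhoff_sum f \<psi> n (\<omega> j))\<bar>
    \<le> real r * (real n * v + real m * B)" by (rule Suc.IH) (rule Suc.prems, auto)
  have 2: "\<bar>birkhoff_sum f \<psi> n ?y - birkhoff_sum f \<psi> n (\<omega> r)\<bar> \<le> real n * v"
  proof (rule birkhoff_sum_diff_le)
    fix i assume "i < n"
    thus "\<bar>\<psi> ((f ^^ i) ?y) - \<psi> ((f ^^ i) (\<omega> r))\<bar> \<le> v"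
      using Suc.prems[of r i] by (simp add: funpow_add)
  qed
  have 3: "\<bar>birkhoff_sum f \<psi> m ((f ^^ n) ?y)\<bar> \<le> real m * B"
    by (rule abs_birkhoff_sum_le[OF B])
  have "Suc r * (n + m) = r * (n + m) + (n + m)" by simp
  hence "birkhoff_sum f \<psi> (Suc r * (n + m)) z = birkhoff_sum f \<psi> (r * (n + m)) z
      + birkhoff_sum f \<psi> n ?y + birkhoff_sum f \<psi> m ((f ^^ n) ?y)"
    by (simp only: birkhoff_sum_add add.assoc)
  moreover have "real (Suc r) * (real n * v + real m * B)
      = real r * (real n * v + real m * B) + real n * v + real m * B"
    by (simp add: algebra_simps)
  ultimately show ?case using 1 2 3 by simp
qed (simp add: birkhoff_sum_def)

context compact_system begin

text \<open>The points \<open>z\<close> admissible for \<open>Z\<close> form an intersection of closed sets \<open>D j\<close>, one for each block, so a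
  finite subcover of \<open>Z\<close> already covers the points subject to finitely many of these constraints; the
  mass distribution principle is thus applied to a finite product of alphabets.\<close>

lemma moran_pressure_lower_bound:
  assumes \<psi>: "continuous_on UNIV \<psi>" and B: "B \<ge> 0" "\<And>x. \<bar>\<psi> x\<bar> \<le> B" and \<epsilon>: "\<epsilon> > 0"
    and v: "v \<ge> 0" "\<And>x y. dist x y \<le> \<epsilon> \<Longrightarrow> \<bar>\<psi> x - \<psi> y\<bar> \<le> v" and n: "n > 0"
    and E: "\<And>j. E j \<in> separated_sets f n (4 * \<epsilon>)" "\<And>j. E j \<noteq> {}"
    and glue: "\<And>M \<omega>. (\<And>j. j < M \<Longrightarrow> \<omega> j \<in> E j) \<Longrightarrow>
      \<exists>z. \<forall>j<M. \<forall>p<n. dist ((f ^^ (p + j * (n + m))) z) ((f ^^ p) (\<omega> j)) < \<epsilon>"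
    and A: "\<And>r. real r * real (n + m) * A \<le> (\<Sum>j<r. ln (\<Sum>e\<in>E j. exp (birkhoff_sum f \<psi> n e)))"
    and Z: "\<And>z. (\<And>j. \<exists>e\<in>E j. \<forall>p<n. dist ((f ^^ (p + j * (n + m))) z) ((f ^^ p) e) \<le> \<epsilon>) \<Longrightarrow> z \<in> Z"
  shows "ereal (A - v - real m / real (n + m) * B) \<le> pressure_at_scale f Z \<psi> \<epsilon>"
  unfolding pressure_at_scale_def
proof (rule INF_greatest, rule ccontr)
  fix \<alpha> assume "\<alpha> \<in> {\<alpha>. pressure_outer_measure f Z \<alpha> \<epsilon> \<psi> = 0}"
  hence zero: "(INF \<Gamma>\<in>bowen_covers f Z \<epsilon> N. cover_weight f \<psi> \<alpha> \<epsilon> \<Gamma>) = 0" for N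
    by (simp add: pressure_outer_measure_eq_0_iff)
  assume "\<not> ereal (A - v - real m / real (n + m) * B) \<le> ereal \<alpha>"
  hence \<alpha>: "\<alpha> < A - v - real m / real (n + m) * B" by simp
  define L where "L = n + m"
  have L: "L > 0" using n by (simp add: L_def)
  \<comment> \<open>\<open>K\<close> bounds the loss from the incomplete last block of a Bowen ball:
    \<open>L * B\<close> in the Birkhoff sum and \<open>L * \<bar>A\<bar>\<close> in the
    normalisation. It does not depend on the ball, so a cover of weight below
    \<open>exp (- K)\<close> will be contradictory.\<close>
  define K where "K = real L * (B + \<bar>A\<bar>)"
  define D where "D j = {z. \<exists>e\<in>E j. \<forall>p<n. dist ((f ^^ (p + j * L)) z) ((f ^^ p) e) \<le> \<epsilon>}" for j
  define S where "S = birkhoff_sum f \<psi>"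
  define Zs where "Zs j = (\<Sum>e\<in>E j. exp (S n e))" for j
  have finE: "finite (E j)" for j using E(1)[of j] by (auto simp: separated_sets_def)
  have Zs_pos: "Zs j > 0" for j unfolding Zs_def by (rule sum_pos[OF finE E(2)]) simp
  have "(INF \<Gamma>\<in>bowen_covers f Z \<epsilon> 0. cover_weight f \<psi> \<alpha> \<epsilon> \<Gamma>) < ennreal (exp (- K))"
    unfolding zero by simp
  then obtain \<Gamma> where \<Gamma>: "\<Gamma> \<in> bowen_covers f Z \<epsilon> 0" "cover_weight f \<psi> \<alpha> \<epsilon> \<Gamma> < ennreal (exp (- K))"
    unfolding INF_less_iff by blast
  have closed_D: "closed (D j)" for j
  proof -
    have "D j = (\<Union>e\<in>E j. \<Inter>p<n. {z. dist ((f ^^ (p + j * L)) z) ((f ^^ p) e) \<le> \<epsilon>})"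
      unfolding D_def by blast
    moreover have "closed {z. dist ((f ^^ (p + j * L)) z) ((f ^^ p) e) \<le> \<epsilon>}" for p e
      by (intro closed_Collect_le continuous_on_dist continuous_funpow continuous_on_const)
    ultimately show ?thesis using finE by (simp add: closed_INT closed_UN)
  qed
  \<comment> \<open>The balls of the cover and the complements of the sets \<open>D j\<close>
    together form an open cover of the compact space.\<close>
  define U where "U i = (case i of Inl g \<Rightarrow> bowen_ball f (fst g) (snd g) \<epsilon> | Inr j \<Rightarrow> - D j)"
    for i :: "(nat \<times> 'a) + nat"
  have "UNIV \<subseteq> (\<Union>i\<in>Inl ` \<Gamma> \<union> range Inr. U i)"
  proof
    fix z :: 'a
    show "z \<in> (\<Union>i\<in>Inl ` \<Gamma> \<union> range Inr. U i)"
    proof (cases "\<forall>j. z \<in> D j")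
      case True
      hence "z \<in> Z" by (intro Z) (simp add: D_def L_def)
      hence "z \<in> (\<Union>(n, x)\<in>\<Gamma>. bowen_ball f n x \<epsilon>)"
        using \<Gamma>(1) unfolding bowen_covers_def by blast
      hence "\<exists>g\<in>\<Gamma>. z \<in> bowen_ball f (fst g) (snd g) \<epsilon>" by (auto simp: case_prod_unfold)
      then obtain g where "g \<in> \<Gamma>" "z \<in> U (Inl g)" by (auto simp: U_def)
      thus ?thesis by blast
    next
      case False
      then obtain j where "z \<in> U (Inr j)" by (auto simp: U_def)
      thus ?thesis by blast
    qed
  qed
  moreover have "open (U i)" for i
    by (cases i) (auto simp: U_def open_bowen_ball closed_D open_Compl)
  ultimately obtain F where F: "F \<subseteq> Inl ` \<Gamma> \<union> range Inr" "finite F" "UNIV \<subseteq> (\<Union>i\<in>F. U i)"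
    using compactE_image[OF compact_UNIV] by metis
  define G where "G = Inl -` F"
  have G: "finite G" "G \<subseteq> \<Gamma>"
    using F(1,2) by (auto simp: G_def intro!: finite_vimageI)
  have "finite (Inr -` F)" "finite (fst ` G)" using F(2) G(1) by (auto intro!: finite_vimageI)
  then obtain M1 M2 where M12: "Inr -` F \<subseteq> {..<M1}" "fst ` G \<subseteq> {..<M2}"
    using finite_nat_bounded by meson
  \<comment> \<open>\<open>M\<close> exceeds all block indices in the finite subcover, so that the
    first \<open>M\<close> constraints force a point into one of the balls, and also all ball
    lengths, so that every ball sees only blocks below \<open>M\<close>.\<close>
  define M where "M = max M1 M2"
  have MG: "fst g < M" if "g \<in> G" for g using M12(2) that by (fastforce simp: M_def)
  have cover: "\<exists>g\<in>G. z \<in> bowen_ball f (fst g) (snd g) \<epsilon>" if z: "\<And>j. j < M \<Longrightarrow> z \<in> D j" for z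
  proof -
    obtain i where i: "i \<in> F" "z \<in> U i" using F(3) by blast
    show ?thesis
    proof (cases i)
      case (Inl g)
      thus ?thesis using i by (auto simp: G_def U_def)
    next
      case (Inr j)
      hence "j < M" using M12(1) i(1) by (auto simp: M_def less_max_iff_disj)
      thus ?thesis using z[of j] i(2) Inr by (simp add: U_def)
    qed
  qed
  define \<Omega> where "\<Omega> = PiE {..<M} E"
  have fin\<Omega>: "finite \<Omega>" unfolding \<Omega>_def by (intro finite_PiE finE) simp
  have "\<forall>\<omega>\<in>\<Omega>. \<exists>z. \<forall>j<M. \<forall>p<n. dist ((f ^^ (p + j * L)) z) ((f ^^ p) (\<omega> j)) < \<epsilon>"
    unfolding L_def by (intro ballI glue) (auto simp: \<Omega>_def PiE_def Pi_def)
  then obtain z where z: "\<And>\<omega> j p. \<omega> \<in> \<Omega> \<Longrightarrow> j < M \<Longrightarrow> p < n \<Longrightarrow>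
      dist ((f ^^ (p + j * L)) (z \<omega>)) ((f ^^ p) (\<omega> j)) < \<epsilon>" by metis
  have \<Omega>E: "\<omega> j \<in> E j" if "\<omega> \<in> \<Omega>" "j < M" for \<omega> j using that by (auto simp: \<Omega>_def)
  \<comment> \<open>Gibbs weights on each alphabet; their product \<open>w\<close> is a probability
    on the finite set of words.\<close>
  define g where "g j e = exp (S n e) / Zs j" for j e
  define w where "w \<omega> = (\<Prod>j<M. g j (\<omega> j))" for \<omega>
  have g_nonneg: "g j e \<ge> 0" for j e using Zs_pos[of j] by (simp add: g_def)
  have w_nonneg: "w \<omega> \<ge> 0" for \<omega> unfolding w_def by (intro prod_nonneg) (simp add: g_nonneg)
  have g_sum: "(\<Sum>e\<in>E j. g j e) = 1" for j
    using Zs_pos[of j] unfolding g_def sum_divide_distrib[symmetric] Zs_def[symmetric] by simp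
  have w_sum: "(\<Sum>\<omega>\<in>\<Omega>. w \<omega>) = 1"
  proof -
    have "(\<Sum>\<omega>\<in>\<Omega>. w \<omega>) = (\<Prod>j<M. \<Sum>e\<in>E j. g j e)"
      unfolding w_def \<Omega>_def by (rule prod_sum_PiE[symmetric]) (auto simp: finE)
    thus ?thesis by (simp add: g_sum)
  qed
  define b where "b h = exp (- \<alpha> * real (fst h) + (SUP y\<in>bowen_ball f (fst h) (snd h) \<epsilon>. S (fst h) y))"
    for h :: "nat \<times> 'a"
  define In where "In h = {\<omega> \<in> \<Omega>. z \<omega> \<in> bowen_ball f (fst h) (snd h) \<epsilon>}" for h :: "nat \<times> 'a"
  \<comment> \<open>The mass distribution estimate: the words whose shadowing point falls into a
    Bowen ball carry at most a constant times the cover weight of that ball.\<close>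
  have cyl: "(\<Sum>\<omega>\<in>In h. w \<omega>) \<le> exp K * b h" if h: "h \<in> G" for h
  proof (cases "In h = {}")
    case True
    thus ?thesis by (simp add: b_def)
  next
    case False
    then obtain \<eta> where \<eta>: "\<eta> \<in> In h" by blast
    hence \<eta>\<Omega>: "\<eta> \<in> \<Omega>" by (simp add: In_def)
    define N where "N = fst h"
    \<comment> \<open>The number of complete periods, block plus gap, within the ball length
      \<open>N\<close>.\<close>
    define r where "r = N div L"
    have rL: "r * L \<le> N" "N < r * L + L"
      using dividend_less_times_div[OF L, of N] div_times_less_eq_dividend[of N L]
      by (simp_all add: r_def mult.commute add.commute)
    have "r \<le> N" by (simp add: r_def)
    hence rM: "r < M" using MG[OF h] by (simp add: N_def)
    have time: "p + j * L < N" if "j < r" "p < n" for j p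
    proof -
      have "p + j * L < L + j * L" using that by (simp add: L_def)
      also have "\<dots> = Suc j * L" by simp
      also have "\<dots> \<le> r * L" using that by (intro mult_le_mono1) simp
      finally show ?thesis using rL(1) by simp
    qed
    \<comment> \<open>Two letters shadowed by points of one ball are joined by four steps shorter
      than \<open>\<epsilon>\<close>; this is why the alphabets are separated at scale
      \<open>4 * \<epsilon>\<close>.\<close>
    have agree: "\<omega> j = \<eta> j" if \<omega>: "\<omega> \<in> In h" and j: "j < r" for \<omega> j
    proof (rule ccontr)
      assume ne: "\<omega> j \<noteq> \<eta> j"
      have \<omega>\<Omega>: "\<omega> \<in> \<Omega>" using \<omega> by (simp add: In_def)
      have jM: "j < M" using j rM by simp
      have "\<omega> j \<in> E j" "\<eta> j \<in> E j" using \<Omega>E \<omega>\<Omega> \<eta>\<Omega> jM by auto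
      with ne obtain p where p: "p < n" "dist ((f ^^ p) (\<omega> j)) ((f ^^ p) (\<eta> j)) > 4 * \<epsilon>"
        using E(1)[of j] unfolding separated_sets_def by blast
      let ?i = "p + j * L"
      have "dist ((f ^^ ?i) (snd h)) ((f ^^ ?i) (z \<omega>)) < \<epsilon>" "dist ((f ^^ ?i) (snd h)) ((f ^^ ?i) (z \<eta>)) < \<epsilon>"
        using \<omega> \<eta> time[OF j p(1)] unfolding In_def bowen_ball_def N_def by blast+
      moreover have "dist ((f ^^ ?i) (z \<omega>)) ((f ^^ p) (\<omega> j)) < \<epsilon>" "dist ((f ^^ ?i) (z \<eta>)) ((f ^^ p) (\<eta> j)) < \<epsilon>"
        using z \<omega>\<Omega> \<eta>\<Omega> jM p(1) by blast+
      moreover note dist_triangle3[of "(f ^^ p) (\<omega> j)" "(f ^^ p) (\<eta> j)" "(f ^^ ?i) (z \<omega>)"]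
        dist_triangle3[of "(f ^^ ?i) (z \<omega>)" "(f ^^ p) (\<eta> j)" "(f ^^ ?i) (snd h)"]
        dist_triangle[of "(f ^^ ?i) (snd h)" "(f ^^ p) (\<eta> j)" "(f ^^ ?i) (z \<eta>)"]
      ultimately show False using p(2) by linarith
    qed
    \<comment> \<open>The first \<open>r\<close> letters are frozen, while the later coordinates
      each sum to 1 and drop out of the product.\<close>
    define E' where "E' j = (if j < r then {\<eta> j} else E j)" for j
    have sub: "In h \<subseteq> PiE {..<M} E'"
    proof
      fix \<omega> assume \<omega>: "\<omega> \<in> In h"
      hence "\<omega> \<in> \<Omega>" by (simp add: In_def)
      thus "\<omega> \<in> PiE {..<M} E'" using agree[OF \<omega>] by (auto simp: \<Omega>_def E'_def PiE_def Pi_def)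
    qed
    have finE': "finite (E' j)" for j by (simp add: E'_def finE)
    have "(\<Sum>\<omega>\<in>In h. w \<omega>) \<le> (\<Sum>\<omega>\<in>PiE {..<M} E'. w \<omega>)"
      by (intro sum_mono2 sub finite_PiE finE' w_nonneg) simp
    also have "\<dots> = (\<Prod>j<M. \<Sum>e\<in>E' j. g j e)"
      unfolding w_def by (rule prod_sum_PiE[symmetric]) (auto simp: finE')
    also have "\<dots> = (\<Prod>j<M. if j \<in> {..<r} then g j (\<eta> j) else 1)"
      by (intro prod.cong refl) (simp add: E'_def g_sum)
    also have "\<dots> = (\<Prod>j<r. g j (\<eta> j))"
      using rM by (subst prod.inter_restrict[symmetric]) (auto intro!: prod.cong)
    also have "\<dots> = (\<Prod>j<r. exp (S n (\<eta> j) - ln (Zs j)))"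
      by (intro prod.cong refl) (simp add: g_def exp_diff Zs_pos)
    also have "\<dots> = exp (\<Sum>j<r. S n (\<eta> j) - ln (Zs j))" by (simp add: exp_sum)
    also have "\<dots> \<le> exp (K + (- \<alpha> * real N + (SUP y\<in>bowen_ball f N (snd h) \<epsilon>. S N y)))"
    \<comment> \<open>The Birkhoff sum of the shadowing point replaces the letter sums at the cost
      of \<open>v\<close> and the gaps, and hypothesis \<open>A\<close> bounds the normalising
      constants; both costs per unit time fit into the distance of \<open>\<alpha>\<close> below
      \<open>A\<close>.\<close>
    proof (subst exp_le_cancel_iff)
      have "\<bar>S (r * L) (z \<eta>) - (\<Sum>j<r. S n (\<eta> j))\<bar> \<le> real r * (real n * v + real m * B)"
        unfolding S_def L_def
      proof (rule birkhoff_sum_shadow[OF B(2)])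
        fix j p assume "j < r" "p < n"
        thus "\<bar>\<psi> ((f ^^ (p + j * (n + m))) (z \<eta>)) - \<psi> ((f ^^ p) (\<eta> j))\<bar> \<le> v"
          using z[OF \<eta>\<Omega>, of j p] rM unfolding L_def by (intro v(2)) simp
      qed
      moreover have "\<bar>S N (z \<eta>) - S (r * L) (z \<eta>)\<bar> \<le> real L * B"
      proof -
        have "N = r * L + (N - r * L)" using rL(1) by simp
        hence "S N (z \<eta>) = S (r * L) (z \<eta>) + S (N - r * L) ((f ^^ (r * L)) (z \<eta>))"
          unfolding S_def by (metis birkhoff_sum_add)
        moreover have "\<bar>S (N - r * L) ((f ^^ (r * L)) (z \<eta>))\<bar> \<le> real (N - r * L) * B"
          unfolding S_def by (rule abs_birkhoff_sum_le[OF B(2)])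
        moreover have "real (N - r * L) * B \<le> real L * B"
          using rL(2) B(1) by (intro mult_right_mono) auto
        ultimately show ?thesis by linarith
      qed
      moreover have "S N (z \<eta>) \<le> (SUP y\<in>bowen_ball f N (snd h) \<epsilon>. S N y)"
        unfolding S_def using \<eta> by (intro cSUP_upper bdd_above_birkhoff_sum[OF B(2)]) (simp add: In_def N_def)
      moreover have "real r * real L * A \<le> (\<Sum>j<r. ln (Zs j))"
        using A[of r] unfolding L_def Zs_def S_def .
      moreover have "(real N - real r * real L) * A \<le> real L * \<bar>A\<bar>"
      proof -
        have r1: "real r * real L \<le> real N" "real N \<le> real r * real L + real L"
          using rL by (simp_all flip: of_nat_mult of_nat_add)
        have "(real N - real r * real L) * A \<le> (real N - real r * real L) * \<bar>A\<bar>"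
          using r1 by (intro mult_left_mono) auto
        also have "\<dots> \<le> real L * \<bar>A\<bar>" using r1 by (intro mult_right_mono) auto
        finally show ?thesis .
      qed
      moreover have "real r * (real n * v) \<le> real N * v"
      proof -
        have "r * n \<le> r * L" by (simp add: L_def)
        hence "r * n \<le> N" using rL(1) by linarith
        hence "real r * real n \<le> real N" by (simp flip: of_nat_mult)
        hence "real r * real n * v \<le> real N * v" using v(1) by (intro mult_right_mono)
        thus ?thesis by (simp add: mult.assoc)
      qed
      moreover have "real r * (real m * B) \<le> real N * (real m / real L * B)"
      proof -
        have "real r * real L \<le> real N" using rL by (simp flip: of_nat_mult)
        hence "real r * real L * (real m / real L * B) \<le> real N * (real m / real L * B)"
          using B(1) by (intro mult_right_mono) auto
        moreover have "real r * real L * (real m / real L * B) = real r * (real m * B)" using L by simp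
        ultimately show ?thesis by simp
      qed
      moreover have "\<alpha> * real N \<le> (A - v - real m / real L * B) * real N"
        using \<alpha> unfolding L_def by (intro mult_right_mono) auto
      moreover have "(\<Sum>j<r. S n (\<eta> j) - ln (Zs j)) = (\<Sum>j<r. S n (\<eta> j)) - (\<Sum>j<r. ln (Zs j))"
        by (rule sum_subtractf)
      ultimately show "(\<Sum>j<r. S n (\<eta> j) - ln (Zs j))
          \<le> K + (- \<alpha> * real N + (SUP y\<in>bowen_ball f N (snd h) \<epsilon>. S N y))"
        unfolding K_def by (simp add: algebra_simps)
    qed
    also have "\<dots> = exp K * b h" by (simp add: b_def N_def exp_add)
    finally show ?thesis .
  qed
  \<comment> \<open>Every shadowing point lies in some ball of \<open>G\<close>, so summing the ball
    estimates bounds the weight of the cover below by \<open>exp (- K)\<close>.\<close>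
  have "1 = (\<Sum>\<omega>\<in>\<Omega>. w \<omega>)" by (simp add: w_sum)
  also have "\<dots> \<le> (\<Sum>\<omega>\<in>\<Omega>. \<Sum>h\<in>G. if \<omega> \<in> In h then w \<omega> else 0)"
  proof (intro sum_mono)
    fix \<omega> assume \<omega>: "\<omega> \<in> \<Omega>"
    have "\<exists>h\<in>G. z \<omega> \<in> bowen_ball f (fst h) (snd h) \<epsilon>"
    proof (rule cover)
      fix j assume j: "j < M"
      show "z \<omega> \<in> D j" unfolding D_def
        using z[OF \<omega> j] \<Omega>E[OF \<omega> j] by (auto intro!: bexI[of _ "\<omega> j"] less_imp_le)
    qed
    then obtain h where h: "h \<in> G" "\<omega> \<in> In h" using \<omega> by (auto simp: In_def)
    have "w \<omega> = (if \<omega> \<in> In h then w \<omega> else 0)" using h by simp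
    also have "\<dots> \<le> (\<Sum>h\<in>G. if \<omega> \<in> In h then w \<omega> else 0)"
      by (rule member_le_sum[OF h(1) _ G(1)]) (simp add: w_nonneg)
    finally show "w \<omega> \<le> (\<Sum>h\<in>G. if \<omega> \<in> In h then w \<omega> else 0)" .
  qed
  also have "\<dots> = (\<Sum>h\<in>G. \<Sum>\<omega>\<in>\<Omega>. if \<omega> \<in> In h then w \<omega> else 0)" by (rule sum.swap)
  also have "\<dots> = (\<Sum>h\<in>G. \<Sum>\<omega>\<in>In h. w \<omega>)"
  proof (rule sum.cong[OF refl])
    fix h
    have "In h = \<Omega> \<inter> In h" by (auto simp: In_def)
    thus "(\<Sum>\<omega>\<in>\<Omega>. if \<omega> \<in> In h then w \<omega> else 0) = (\<Sum>\<omega>\<in>In h. w \<omega>)"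
      using sum.inter_restrict[OF fin\<Omega>, of w "In h"] by simp
  qed
  also have "\<dots> \<le> (\<Sum>h\<in>G. exp K * b h)" by (intro sum_mono cyl)
  also have "\<dots> = exp K * (\<Sum>h\<in>G. b h)" by (simp add: sum_distrib_left)
  finally have "exp (- K) * 1 \<le> exp (- K) * (exp K * (\<Sum>h\<in>G. b h))" by (intro mult_left_mono) auto
  hence "exp (- K) \<le> (\<Sum>h\<in>G. b h)" by (simp add: exp_minus field_simps)
  hence "ennreal (exp (- K)) \<le> ennreal (\<Sum>h\<in>G. b h)" by (rule ennreal_leI)
  also have "\<dots> = (\<Sum>h\<in>G. ennreal (b h))" by (rule sum_ennreal[symmetric]) (simp add: b_def)
  also have "\<dots> \<le> (\<Sum>\<^sub>\<infinity>h\<in>\<Gamma>. ennreal (b h))"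
    by (subst nonneg_infsum_complete) (use G in \<open>auto intro!: SUP_upper\<close>)
  also have "\<dots> = cover_weight f \<psi> \<alpha> \<epsilon> \<Gamma>"
    unfolding cover_weight_def b_def S_def by (simp add: case_prod_unfold)
  finally show False using \<Gamma>(2) by simp
qed

end

section \<open>Entropy of partitions\<close>

text \<open>\<open>ln x \<le> x - 1\<close> at \<open>x = w i / p i\<close>, weighted by
  \<open>p i\<close> and summed. The total of \<open>w\<close> may be smaller than that of
  \<open>p\<close>, so \<open>w\<close> can be a subprobability.\<close>

lemma gibbs_inequality:
  fixes p w :: "'i \<Rightarrow> real"
  assumes "finite I" and p: "\<And>i. i \<in> I \<Longrightarrow> 0 \<le> p i" and w: "\<And>i. i \<in> I \<Longrightarrow> 0 \<le> w i"
    and pos: "\<And>i. i \<in> I \<Longrightarrow> 0 < p i \<Longrightarrow> 0 < w i"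
    and sum: "(\<Sum>i\<in>I. w i) \<le> (\<Sum>i\<in>I. p i)"
  shows "(\<Sum>i\<in>I. p i * ln (w i)) \<le> (\<Sum>i\<in>I. p i * ln (p i))"
proof -
  have "p i * ln (w i) - p i * ln (p i) \<le> w i - p i" if i: "i \<in> I" for i
  proof (cases "p i = 0")
    case False
    hence pi: "p i > 0" "w i > 0" using p[OF i] pos[OF i] by auto
    have "ln (w i / p i) \<le> w i / p i - 1" using pi by (intro ln_le_minus_one) simp
    hence "p i * ln (w i / p i) \<le> p i * (w i / p i - 1)" using pi by (intro mult_left_mono) auto
    thus ?thesis using pi by (simp add: ln_div right_diff_distrib)
  qed (use w[OF i] in simp)
  hence "(\<Sum>i\<in>I. p i * ln (w i) - p i * ln (p i)) \<le> (\<Sum>i\<in>I. w i - p i)" by (rule sum_mono)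
  thus ?thesis using sum by (simp add: sum_subtractf)
qed

text \<open>Fekete's subadditive lemma: choose \<open>N\<close> nearly optimal for the infimum
  \<open>l\<close> of the quotients and divide \<open>n\<close> by \<open>N\<close> with remainder;
  the remainder costs at most a constant \<open>C\<close>, negligible against
  \<open>n\<close>.\<close>

lemma fekete:
  fixes h :: "nat \<Rightarrow> real"
  assumes h: "\<And>n. h n \<ge> 0" and sub: "\<And>m n. h (m + n) \<le> h m + h n"
  shows "convergent (\<lambda>n. h n / real n)"
proof -
  define l where "l = (INF n\<in>{1..}. h n / real n)"
  have bdd: "bdd_below ((\<lambda>n. h n / real n) ` {1..})"
    by (rule bdd_belowI2[of _ 0]) (simp add: h)
  have l_le: "l \<le> h n / real n" if "n \<ge> 1" for n
    unfolding l_def using that by (intro cINF_lower bdd) simp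
  have "(\<lambda>n. h n / real n) \<longlonglongrightarrow> l"
  proof (rule LIMSEQ_I)
    fix e :: real assume e: "e > 0"
    have "(INF n\<in>{1..}. h n / real n) < l + e / 2" using e by (simp add: l_def)
    then obtain N where N: "N \<ge> 1" "h N / real N < l + e / 2"
      by (subst (asm) cINF_less_iff[OF _ bdd]) auto
    define C where "C = (\<Sum>r<N. h r)"
    have C: "h r \<le> C" if "r < N" for r
      unfolding C_def using that h by (intro member_le_sum) auto
    have mult: "h (q * N + r) \<le> real q * h N + h r" for q r
    proof (induction q)
      case (Suc q)
      have "h (Suc q * N + r) \<le> h N + h (q * N + r)" using sub[of N "q * N + r"] by (simp add: add.assoc)
      thus ?case using Suc by (simp add: algebra_simps)
    qed simp
    obtain n0 :: nat where n0: "real n0 > 2 * C / e" using reals_Archimedean2 by blast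
    show "\<exists>no. \<forall>n\<ge>no. norm (h n / real n - l) < e"
    proof (intro exI allI impI)
      fix n assume n: "n \<ge> max n0 1"
      define q r where "q = n div N" and "r = n mod N"
      have nqr: "n = q * N + r" by (simp add: q_def r_def)
      have "r < N" using N(1) by (simp add: r_def)
      have "h n \<le> real q * h N + C" using mult[of q r] C[OF \<open>r < N\<close>] by (simp add: nqr)
      also have "real q * h N = real (q * N) * (h N / real N)" using N(1) by simp
      also have "\<dots> \<le> real n * (h N / real N)"
      proof (rule mult_right_mono)
        have "q * N \<le> n" using nqr by linarith
        thus "real (q * N) \<le> real n" by (rule of_nat_mono)
      qed (simp add: h)
      finally have "h n / real n \<le> h N / real N + C / real n"
        using n by (simp add: field_simps)
      moreover have "C / real n < e / 2"
      proof -
        have "real n > 2 * C / e" using n0 n by (meson le_less_trans less_le_trans max.bounded_iff of_nat_mono)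
        thus ?thesis using e n by (simp add: field_simps)
      qed
      ultimately have "h n / real n < l + e" using N(2) by linarith
      moreover have "l \<le> h n / real n" using l_le n by simp
      ultimately show "norm (h n / real n - l) < e" by simp
    qed
  qed
  thus ?thesis by (rule convergentI)
qed

lemma (in prob_space) sum_prob_inter_partition:
  assumes "finite J" and B: "\<And>j. j \<in> J \<Longrightarrow> B j \<in> events" "disjoint_family_on B J" "(\<Union>j\<in>J. B j) = space M"
    and C: "C \<in> events"
  shows "(\<Sum>j\<in>J. prob (C \<inter> B j)) = prob C"
proof -
  have "C = (\<Union>j\<in>J. C \<inter> B j)" using B(3) sets.sets_into_space[OF C] by blast
  also have "prob \<dots> = (\<Sum>j\<in>J. prob (C \<inter> B j))"
    using B C assms(1) by (intro finite_measure_finite_Union) (auto simp: disjoint_family_on_def)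
  finally show ?thesis ..
qed

text \<open>Gibbs' inequality for the joint distribution against the product of its marginals. A
  pair of positive joint probability has positive marginals, so the logarithm splits wherever it
  counts.\<close>

lemma (in prob_space) joint_entropy_le:
  assumes fin: "finite I" "finite J"
    and A: "\<And>i. i \<in> I \<Longrightarrow> A i \<in> events" "disjoint_family_on A I" "(\<Union>i\<in>I. A i) = space M"
    and B: "\<And>j. j \<in> J \<Longrightarrow> B j \<in> events" "disjoint_family_on B J" "(\<Union>j\<in>J. B j) = space M"
  shows "- (\<Sum>(i,j)\<in>I \<times> J. prob (A i \<inter> B j) * ln (prob (A i \<inter> B j)))
    \<le> - (\<Sum>i\<in>I. prob (A i) * ln (prob (A i))) - (\<Sum>j\<in>J. prob (B j) * ln (prob (B j)))"
proof -
  have sum1: "(\<Sum>j\<in>J. prob (C \<inter> B j)) = prob C" if "C \<in> events" for C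
    by (rule sum_prob_inter_partition[OF fin(2) B that])
  have sum2: "(\<Sum>i\<in>I. prob (A i \<inter> C)) = prob C" if "C \<in> events" for C
    using sum_prob_inter_partition[OF fin(1) A that] by (simp add: Int_commute)
  have one: "(\<Sum>i\<in>I. prob (A i)) = 1"
  proof -
    have "(\<Sum>i\<in>I. prob (A i)) = (\<Sum>i\<in>I. prob (A i \<inter> space M))"
      by (intro sum.cong refl) (simp add: A(1) sets.Int_space_eq2)
    also have "\<dots> = 1" using sum2[of "space M"] by (simp add: prob_space)
    finally show ?thesis .
  qed
  have two: "(\<Sum>j\<in>J. prob (B j)) = 1"
  proof -
    have "(\<Sum>j\<in>J. prob (B j)) = (\<Sum>j\<in>J. prob (space M \<inter> B j))"
      by (intro sum.cong refl) (simp add: B(1) sets.Int_space_eq1)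
    also have "\<dots> = 1" using sum1[of "space M"] by (simp add: prob_space)
    finally show ?thesis .
  qed
  let ?p = "\<lambda>(i, j). prob (A i \<inter> B j)" and ?w = "\<lambda>(i, j). prob (A i) * prob (B j)"
  have le: "prob (A i \<inter> B j) \<le> prob (A i)" "prob (A i \<inter> B j) \<le> prob (B j)" if "i \<in> I" "j \<in> J" for i j
    using that A(1) B(1) by (auto intro!: finite_measure_mono)
  have eq: "(\<Sum>k\<in>I \<times> J. ?p k * ln (?w k)) =
      (\<Sum>i\<in>I. prob (A i) * ln (prob (A i))) + (\<Sum>j\<in>J. prob (B j) * ln (prob (B j)))"
  proof -
    have "(\<Sum>k\<in>I \<times> J. ?p k * ln (?w k)) =
        (\<Sum>i\<in>I. \<Sum>j\<in>J. prob (A i \<inter> B j) * ln (prob (A i)) + prob (A i \<inter> B j) * ln (prob (B j)))"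
      unfolding sum.cartesian_product
    proof (intro sum.cong refl)
      fix k assume k: "k \<in> I \<times> J"
      show "?p k * ln (?w k) = (case k of (i, j) \<Rightarrow>
        prob (A i \<inter> B j) * ln (prob (A i)) + prob (A i \<inter> B j) * ln (prob (B j)))"
      proof (cases "?p k = 0")
        case False
        obtain i j where ij: "k = (i, j)" "i \<in> I" "j \<in> J" using k by auto
        have "0 < prob (A i \<inter> B j)" using False ij(1) by (simp add: zero_less_measure_iff)
        hence "prob (A i) > 0" "prob (B j) > 0" using le[OF ij(2,3)] by linarith+
        thus ?thesis by (simp add: ij(1) ln_mult algebra_simps)
      qed (auto simp: case_prod_unfold)
    qed
    also have "\<dots> = (\<Sum>i\<in>I. prob (A i) * ln (prob (A i)))
        + (\<Sum>i\<in>I. \<Sum>j\<in>J. prob (A i \<inter> B j) * ln (prob (B j)))"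
      by (simp add: sum.distrib sum_distrib_right[symmetric] sum1 A(1))
    also have "(\<Sum>i\<in>I. \<Sum>j\<in>J. prob (A i \<inter> B j) * ln (prob (B j))) = (\<Sum>j\<in>J. prob (B j) * ln (prob (B j)))"
      by (subst sum.swap) (simp add: sum_distrib_right[symmetric] sum2 B(1))
    finally show ?thesis .
  qed
  have "(\<Sum>k\<in>I \<times> J. ?p k * ln (?w k)) \<le> (\<Sum>k\<in>I \<times> J. ?p k * ln (?p k))"
  proof (rule gibbs_inequality)
    show "finite (I \<times> J)" using fin by simp
    show "(\<Sum>k\<in>I \<times> J. ?w k) \<le> (\<Sum>k\<in>I \<times> J. ?p k)"
    proof -
      have "(\<Sum>k\<in>I \<times> J. ?w k) = 1"
        by (simp add: sum.cartesian_product[symmetric] sum_distrib_left[symmetric] two one)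
      moreover have "(\<Sum>k\<in>I \<times> J. ?p k) = 1"
        by (simp add: sum.cartesian_product[symmetric] sum1 A(1) one)
      ultimately show ?thesis by simp
    qed
    fix k assume k: "k \<in> I \<times> J"
    then obtain i j where ij: "k = (i, j)" "i \<in> I" "j \<in> J" by auto
    show "0 < ?w k" if "0 < ?p k" using that le[OF ij(2,3)] ij(1) by (auto intro: less_le_trans)
  qed (auto simp: case_prod_unfold)
  thus ?thesis unfolding eq by (simp add: case_prod_unfold)
qed

text \<open>Cells are indexed by words rather than collected as sets, so that sums over the join
  become sums over a finite product. For a partition, only the empty cell can belong to several
  words.\<close>

definition itinerary_cell :: "('a \<Rightarrow> 'a) \<Rightarrow> nat \<Rightarrow> (nat \<Rightarrow> 'a set) \<Rightarrow> 'a set" where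
  "itinerary_cell f n a = (\<Inter>i<n. (f ^^ i) -` a i)"

lemma mem_itinerary_cell: "x \<in> itinerary_cell f n a \<longleftrightarrow> (\<forall>i<n. (f ^^ i) x \<in> a i)"
  by (auto simp: itinerary_cell_def)

lemma iterated_join_eq: "iterated_join f P n = itinerary_cell f n ` PiE {..<n} (\<lambda>_. P)"
proof
  show "iterated_join f P n \<subseteq> itinerary_cell f n ` PiE {..<n} (\<lambda>_. P)"
  proof
    fix C assume "C \<in> iterated_join f P n"
    then obtain a where a: "C = (\<Inter>i<n. (f ^^ i) -` a i)" "\<forall>i<n. a i \<in> P"
      unfolding iterated_join_def by blast
    have "C = itinerary_cell f n (restrict a {..<n})"
      unfolding itinerary_cell_def a(1) by (intro INF_cong) auto
    moreover have "restrict a {..<n} \<in> PiE {..<n} (\<lambda>_. P)" using a(2) by auto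
    ultimately show "C \<in> itinerary_cell f n ` PiE {..<n} (\<lambda>_. P)" by blast
  qed
  show "itinerary_cell f n ` PiE {..<n} (\<lambda>_. P) \<subseteq> iterated_join f P n"
    unfolding itinerary_cell_def iterated_join_def by (auto simp: PiE_iff)
qed

lemma itinerary_cell_unique:
  assumes P: "partition_on UNIV P" and a: "a \<in> PiE {..<n} (\<lambda>_. P)" "b \<in> PiE {..<n} (\<lambda>_. P)"
    and x: "x \<in> itinerary_cell f n a" "x \<in> itinerary_cell f n b"
  shows "a = b"
proof (rule PiE_ext[OF a])
  fix i assume i: "i \<in> {..<n}"
  have "(f ^^ i) x \<in> a i \<inter> b i" "a i \<in> P" "b i \<in> P"
    using x a i by (auto simp: itinerary_cell_def)
  thus "a i = b i" using partition_onD2[OF P] by (auto simp: disjoint_def)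
qed

lemma itinerary_cell_exists:
  assumes P: "partition_on UNIV P"
  obtains a where "a \<in> PiE {..<n} (\<lambda>_. P)" "x \<in> itinerary_cell f n a"
proof -
  have "\<exists>A\<in>P. (f ^^ i) x \<in> A" for i using partition_onD1[OF P] by blast
  then obtain a where a: "\<And>i. a i \<in> P" "\<And>i. (f ^^ i) x \<in> a i" by metis
  show ?thesis by (rule that[of "restrict a {..<n}"]) (auto simp: itinerary_cell_def a)
qed

lemma itinerary_cell_add:
  "itinerary_cell f (m + n) a
    = itinerary_cell f m (restrict a {..<m}) \<inter> (f ^^ m) -` itinerary_cell f n (\<lambda>i\<in>{..<n}. a (m + i))"
proof -
  have split: "(\<forall>i<m+n. Q i) \<longleftrightarrow> (\<forall>i<m. Q i) \<and> (\<forall>i<n. Q (m + i))" for Q :: "nat \<Rightarrow> bool"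
  proof (intro iffI conjI allI impI; (elim conjE)?)
    fix i assume Q: "\<forall>i<m. Q i" "\<forall>i<n. Q (m + i)" "i < m + n"
    show "Q i" using Q(1) Q(2)[rule_format, of "i - m"] Q(3) by (cases "i < m") auto
  qed auto
  have iter: "(f ^^ (m + i)) x = (f ^^ i) ((f ^^ m) x)" for i x
    by (simp add: add.commute[of m] funpow_add)
  show ?thesis
  proof (rule set_eqI)
    fix x
    show "x \<in> itinerary_cell f (m + n) a \<longleftrightarrow> x \<in> itinerary_cell f m (restrict a {..<m})
        \<inter> (f ^^ m) -` itinerary_cell f n (\<lambda>i\<in>{..<n}. a (m + i))"
      using split[of "\<lambda>i. (f ^^ i) x \<in> a i"] by (simp add: mem_itinerary_cell iter)
  qed
qed

text \<open>The inverse is concatenation of words. It turns a sum over words of length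
  \<open>m + n\<close> into a double sum, the form required for subadditivity.\<close>

lemma bij_betw_split_itinerary:
  fixes m n :: nat
  shows "bij_betw (\<lambda>a. (restrict a {..<m}, \<lambda>i\<in>{..<n}. a (m + i)))
     (PiE {..<m + n} (\<lambda>_. P)) (PiE {..<m} (\<lambda>_. P) \<times> PiE {..<n} (\<lambda>_. P))"
proof (rule bij_betw_byWitness[where f' = "\<lambda>(b, c). \<lambda>i\<in>{..<m + n}. if i < m then b i else c (i - m)"])
  show "\<forall>a\<in>PiE {..<m + n} (\<lambda>_. P). (case (restrict a {..<m}, \<lambda>i\<in>{..<n}. a (m + i)) of
      (b, c) \<Rightarrow> \<lambda>i\<in>{..<m + n}. if i < m then b i else c (i - m)) = a"
  proof
    fix a assume a: "a \<in> PiE {..<m + n} (\<lambda>_. P)"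
    show "(case (restrict a {..<m}, \<lambda>i\<in>{..<n}. a (m + i)) of
      (b, c) \<Rightarrow> \<lambda>i\<in>{..<m + n}. if i < m then b i else c (i - m)) = a"
      by (rule extensionalityI[of _ "{..<m + n}"]) (use a in \<open>auto simp: PiE_iff\<close>)
  qed
  show "\<forall>bc\<in>PiE {..<m} (\<lambda>_. P) \<times> PiE {..<n} (\<lambda>_. P).
      (\<lambda>a. (restrict a {..<m}, \<lambda>i\<in>{..<n}. a (m + i)))
        (case bc of (b, c) \<Rightarrow> \<lambda>i\<in>{..<m + n}. if i < m then b i else c (i - m)) = bc"
  proof
    fix bc assume "bc \<in> PiE {..<m} (\<lambda>_. P) \<times> PiE {..<n} (\<lambda>_. P)"
    then obtain b c where eq: "bc = (b, c)"
      and bc: "b \<in> PiE {..<m} (\<lambda>_. P)" "c \<in> PiE {..<n} (\<lambda>_. P)" by blast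
    let ?a = "\<lambda>i\<in>{..<m + n}. if i < m then b i else c (i - m)"
    have "restrict ?a {..<m} = b"
      by (rule extensionalityI[of _ "{..<m}"]) (use bc in \<open>auto simp: PiE_iff\<close>)
    moreover have "(\<lambda>i\<in>{..<n}. ?a (m + i)) = c"
      by (rule extensionalityI[of _ "{..<n}"]) (use bc in \<open>auto simp: PiE_iff\<close>)
    ultimately show "(\<lambda>a. (restrict a {..<m}, \<lambda>i\<in>{..<n}. a (m + i)))
        (case bc of (b, c) \<Rightarrow> \<lambda>i\<in>{..<m + n}. if i < m then b i else c (i - m)) = bc"
      by (simp only: eq prod.case)
  qed
  show "(\<lambda>a. (restrict a {..<m}, \<lambda>i\<in>{..<n}. a (m + i))) ` PiE {..<m + n} (\<lambda>_. P)
      \<subseteq> PiE {..<m} (\<lambda>_. P) \<times> PiE {..<n} (\<lambda>_. P)"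
  proof (rule image_subsetI)
    fix a assume a: "a \<in> PiE {..<m + n} (\<lambda>_. P)"
    have "a i \<in> P" if "i < m + n" for i using PiE_mem[OF a, of i] that by simp
    thus "(restrict a {..<m}, \<lambda>i\<in>{..<n}. a (m + i)) \<in> PiE {..<m} (\<lambda>_. P) \<times> PiE {..<n} (\<lambda>_. P)"
      by (simp add: restrict_PiE_iff)
  qed
  show "(\<lambda>(b, c). \<lambda>i\<in>{..<m + n}. if i < m then b i else c (i - m)) `
      (PiE {..<m} (\<lambda>_. P) \<times> PiE {..<n} (\<lambda>_. P)) \<subseteq> PiE {..<m + n} (\<lambda>_. P)"
  proof (rule image_subsetI)
    fix bc assume "bc \<in> PiE {..<m} (\<lambda>_. P) \<times> PiE {..<n} (\<lambda>_. P)"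
    then obtain b c where eq: "bc = (b, c)"
      and bc: "b \<in> PiE {..<m} (\<lambda>_. P)" "c \<in> PiE {..<n} (\<lambda>_. P)" by blast
    have "(if i < m then b i else c (i - m)) \<in> P" if "i < m + n" for i
      using PiE_mem[OF bc(1), of i] PiE_mem[OF bc(2), of "i - m"] that by auto
    thus "(case bc of (b, c) \<Rightarrow> \<lambda>i\<in>{..<m + n}. if i < m then b i else c (i - m)) \<in> PiE {..<m + n} (\<lambda>_. P)"
      unfolding eq prod.case restrict_PiE_iff by blast
  qed
qed

section \<open>Invariant measures and the entropy of iterated joins\<close>

locale invariant_prob = compact_system f + prob_space \<mu>
  for f :: "'a::metric_space \<Rightarrow> 'a" and \<mu> :: "'a measure" +
  assumes sets_eq: "sets \<mu> = sets borel" and invariant: "distr \<mu> \<mu> f = \<mu>"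
begin

lemma space_eq: "space \<mu> = UNIV" using sets_eq_imp_space_eq[OF sets_eq] by simp

lemma continuous_measurable:
  fixes g :: "'a \<Rightarrow> 'b::topological_space"
  assumes "continuous_on UNIV g"
  shows "g \<in> borel_measurable \<mu>"
  using borel_measurable_continuous_onI[OF assms] measurable_cong_sets[OF sets_eq refl] by blast

lemma measurable_funpow: "f ^^ i \<in> measurable \<mu> \<mu>"
  using continuous_measurable[OF continuous_funpow] measurable_cong_sets[OF refl sets_eq] by blast

lemma distr_funpow: "distr \<mu> \<mu> (f ^^ i) = \<mu>"
proof (induction i)
  case 0
  show ?case unfolding funpow.simps by (simp add: distr_id[unfolded id_def[symmetric]] id_def)
next
  case (Suc i)
  have "distr \<mu> \<mu> (f ^^ Suc i) = distr (distr \<mu> \<mu> (f ^^ i)) \<mu> f"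
    using distr_distr[OF measurable_funpow[of 1] measurable_funpow[of i]] by simp
  also have "\<dots> = \<mu>" by (simp add: Suc invariant)
  finally show ?case .
qed

lemma prob_vimage_funpow:
  assumes "A \<in> sets \<mu>"
  shows "prob ((f ^^ i) -` A) = prob A"
  using measure_distr[OF measurable_funpow[of i] assms] by (simp add: distr_funpow space_eq)

lemma continuous_integrable:
  fixes \<psi> :: "'a \<Rightarrow> real"
  assumes "continuous_on UNIV \<psi>"
  shows "integrable \<mu> \<psi>"
proof -
  obtain B where "B \<ge> 0" "\<And>x. \<bar>\<psi> x\<bar> \<le> B" using continuous_bounded[OF assms] by blast
  thus ?thesis by (intro integrable_const_bound[of _ B] continuous_measurable[OF assms]) auto
qed

lemma integral_funpow:
  fixes \<psi> :: "'a \<Rightarrow> real"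
  assumes "\<psi> \<in> borel_measurable \<mu>"
  shows "(\<integral>x. \<psi> ((f ^^ i) x) \<partial>\<mu>) = (\<integral>x. \<psi> x \<partial>\<mu>)"
  using integral_distr[OF measurable_funpow[of i] assms] by (simp add: distr_funpow)

lemma integrable_funpow:
  fixes \<psi> :: "'a \<Rightarrow> real"
  assumes "integrable \<mu> \<psi>"
  shows "integrable \<mu> (\<lambda>x. \<psi> ((f ^^ i) x))"
  using integrable_distr[OF measurable_funpow[of i], of \<psi>] assms by (simp add: distr_funpow)

lemma integral_birkhoff_sum:
  fixes \<psi> :: "'a \<Rightarrow> real"
  assumes "integrable \<mu> \<psi>"
  shows "integrable \<mu> (birkhoff_sum f \<psi> n)"
    and "(\<integral>x. birkhoff_sum f \<psi> n x \<partial>\<mu>) = real n * (\<integral>x. \<psi> x \<partial>\<mu>)"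
proof -
  have eq: "birkhoff_sum f \<psi> n = (\<lambda>x. \<Sum>i<n. \<psi> ((f ^^ i) x))" by (simp add: fun_eq_iff birkhoff_sum_def)
  show "integrable \<mu> (birkhoff_sum f \<psi> n)" unfolding eq
    by (intro Bochner_Integration.integrable_sum integrable_funpow[OF assms])
  show "(\<integral>x. birkhoff_sum f \<psi> n x \<partial>\<mu>) = real n * (\<integral>x. \<psi> x \<partial>\<mu>)" unfolding eq
    using integral_funpow[OF borel_measurable_integrable[OF assms]]
    by (subst Bochner_Integration.integral_sum[OF integrable_funpow[OF assms]]) simp
qed

context
  fixes P :: "'a set set"
  assumes finP: "finite P" and P_sets: "P \<subseteq> sets \<mu>" and P: "partition_on UNIV P"
begin

lemma itinerary_cell_sets:
  assumes "a \<in> PiE {..<n} (\<lambda>_. P)"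
  shows "itinerary_cell f n a \<in> sets \<mu>"
proof -
  have "(f ^^ i) -` a i \<in> sets \<mu>" if "i < n" for i
  proof -
    have "a i \<in> sets \<mu>" using assms that P_sets by auto
    thus ?thesis using measurable_sets[OF measurable_funpow[of i]] by (simp add: space_eq)
  qed
  hence "{x \<in> space \<mu>. \<forall>i\<in>{..<n}. (f ^^ i) x \<in> a i} \<in> sets \<mu>"
    by (intro sets.sets_Collect_finite_All) (auto simp: space_eq vimage_def)
  moreover have "itinerary_cell f n a = {x \<in> space \<mu>. \<forall>i\<in>{..<n}. (f ^^ i) x \<in> a i}"
    by (auto simp: itinerary_cell_def space_eq)
  ultimately show ?thesis by simp
qed

lemma itinerary_cells_partition:
  "finite (PiE {..<n} (\<lambda>_. P))"
  "disjoint_family_on (itinerary_cell f n) (PiE {..<n} (\<lambda>_. P))"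
  "(\<Union>a\<in>PiE {..<n} (\<lambda>_. P). itinerary_cell f n a) = space \<mu>"
proof -
  show "finite (PiE {..<n} (\<lambda>_. P))" using finP by (intro finite_PiE) auto
  show "disjoint_family_on (itinerary_cell f n) (PiE {..<n} (\<lambda>_. P))"
    unfolding disjoint_family_on_def
  proof (intro ballI impI equals0I)
    fix a b x assume "a \<in> PiE {..<n} (\<lambda>_. P)" "b \<in> PiE {..<n} (\<lambda>_. P)" "a \<noteq> b"
      "x \<in> itinerary_cell f n a \<inter> itinerary_cell f n b"
    thus False using itinerary_cell_unique[OF P] by (metis IntE)
  qed
  show "(\<Union>a\<in>PiE {..<n} (\<lambda>_. P). itinerary_cell f n a) = space \<mu>"
    unfolding space_eq
  proof (rule UNIV_eq_I[symmetric])
    fix x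
    obtain a where "a \<in> PiE {..<n} (\<lambda>_. P)" "x \<in> itinerary_cell f n a"
      by (rule itinerary_cell_exists[OF P])
    thus "x \<in> (\<Union>a\<in>PiE {..<n} (\<lambda>_. P). itinerary_cell f n a)" by blast
  qed
qed

text \<open>Different words with the same cell have an empty cell, whose term is 0, so summing over
  words instead of sets changes nothing.\<close>

lemma partition_entropy_iterated_join:
  "partition_entropy \<mu> (iterated_join f P n) =
    - (\<Sum>a\<in>PiE {..<n} (\<lambda>_. P). prob (itinerary_cell f n a) * ln (prob (itinerary_cell f n a)))"
  unfolding partition_entropy_def iterated_join_eq
proof (subst sum.reindex_nontrivial[OF itinerary_cells_partition(1)])
  fix a b assume ab: "a \<in> PiE {..<n} (\<lambda>_. P)" "b \<in> PiE {..<n} (\<lambda>_. P)" "a \<noteq> b"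
    "itinerary_cell f n a = itinerary_cell f n b"
  hence "itinerary_cell f n a = {}" using itinerary_cell_unique[OF P ab(1,2)] by blast
  thus "prob (itinerary_cell f n a) * ln (prob (itinerary_cell f n a)) = 0" by simp
qed simp

lemma partition_entropy_nonneg: "partition_entropy \<mu> (iterated_join f P n) \<ge> 0"
proof -
  have "prob C * ln (prob C) \<le> 0" for C
    by (cases "prob C = 0") (auto simp: mult_le_0_iff zero_less_measure_iff)
  thus ?thesis unfolding partition_entropy_iterated_join by (simp add: sum_nonpos)
qed

text \<open>The longer join is the common refinement of the join of length \<open>m\<close> and the
  preimage under \<open>f ^^ m\<close> of the join of length \<open>n\<close>; invariance of the
  measure makes the entropy of the latter that of the join itself.\<close>

lemma partition_entropy_subadditive:
  "partition_entropy \<mu> (iterated_join f P (m + n))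
    \<le> partition_entropy \<mu> (iterated_join f P m) + partition_entropy \<mu> (iterated_join f P n)"
proof -
  let ?I = "\<lambda>n. PiE {..<n} (\<lambda>_. P)"
  let ?h = "\<lambda>A B. prob (A \<inter> (f ^^ m) -` B) * ln (prob (A \<inter> (f ^^ m) -` B))"
  have sets: "(f ^^ m) -` itinerary_cell f n b \<in> events" if "b \<in> ?I n" for b
    using measurable_sets[OF measurable_funpow itinerary_cell_sets[OF that]] by (simp add: space_eq)
  have "partition_entropy \<mu> (iterated_join f P (m + n)) =
      - (\<Sum>(a, b)\<in>?I m \<times> ?I n. ?h (itinerary_cell f m a) (itinerary_cell f n b))"
    unfolding partition_entropy_iterated_join
    by (subst sum.reindex_bij_betw[OF bij_betw_split_itinerary, symmetric]) (simp add: itinerary_cell_add)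
  also have "\<dots> \<le> - (\<Sum>a\<in>?I m. prob (itinerary_cell f m a) * ln (prob (itinerary_cell f m a)))
      - (\<Sum>b\<in>?I n. prob ((f ^^ m) -` itinerary_cell f n b) * ln (prob ((f ^^ m) -` itinerary_cell f n b)))"
  proof (rule joint_entropy_le)
    show "disjoint_family_on (\<lambda>b. (f ^^ m) -` itinerary_cell f n b) (?I n)"
      using itinerary_cells_partition(2)[of n] unfolding disjoint_family_on_def by blast
    have "(\<Union>b\<in>?I n. (f ^^ m) -` itinerary_cell f n b) = (f ^^ m) -` (\<Union>b\<in>?I n. itinerary_cell f n b)"
      by blast
    thus "(\<Union>b\<in>?I n. (f ^^ m) -` itinerary_cell f n b) = space \<mu>"
      by (simp only: itinerary_cells_partition(3)) (simp add: space_eq)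
  qed (use itinerary_cells_partition itinerary_cell_sets sets in auto)
  also have "\<dots> = partition_entropy \<mu> (iterated_join f P m) + partition_entropy \<mu> (iterated_join f P n)"
    unfolding partition_entropy_iterated_join
    by (simp add: prob_vimage_funpow itinerary_cell_sets)
  finally show ?thesis .
qed

text \<open>Ensures that the \<open>lim\<close> in the definition of the dynamical entropy is an
  actual limit.\<close>

lemma partition_dynamical_entropy_tendsto:
  "(\<lambda>n. partition_entropy \<mu> (iterated_join f P n) / real n) \<longlonglongrightarrow> partition_dynamical_entropy \<mu> f P"
  unfolding partition_dynamical_entropy_def convergent_LIMSEQ_iff[symmetric]
  by (rule fekete[OF partition_entropy_nonneg partition_entropy_subadditive])

end

end

section \<open>Inner regularity\<close>

text \<open>The closed sets of points at distance at least \<open>1/(n+1)\<close> from the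
  complement increase to \<open>U\<close>, and the measure is continuous from below.\<close>

lemma closed_inner_regular_open:
  fixes \<mu> :: "'a::metric_space measure"
  assumes "finite_measure \<mu>" and s: "sets \<mu> = sets borel" and U: "open U" and e: "e > 0"
  obtains K where "closed K" "K \<subseteq> U" "measure \<mu> (U - K) < e"
\<comment> \<open>\<open>infdist\<close> to the empty set is 0 by convention, so the whole space is
  treated separately.\<close>
proof (cases "U = UNIV")
  case True
  show ?thesis by (rule that[of UNIV]) (use True e in auto)
next
  case False
  interpret finite_measure \<mu> by fact
  define K where "K n = {x. inverse (real (Suc n)) \<le> infdist x (- U)}" for n
  have closed_K: "closed (K n)" for n
    unfolding K_def by (intro closed_Collect_le continuous_on_const continuous_on_infdist continuous_on_id)
  have U_eq: "U = (\<Union>n. K n)"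
  proof (rule set_eqI)
    fix x
    have "x \<in> U \<longleftrightarrow> infdist x (- U) > 0"
    proof
      assume "x \<in> U"
      thus "infdist x (- U) > 0" using U False
        by (intro infdist_pos_not_in_closed) auto
    next
      assume *: "infdist x (- U) > 0"
      show "x \<in> U"
      proof (rule ccontr)
        assume "x \<notin> U"
        hence "infdist x (- U) = 0" by (intro infdist_zero) simp
        thus False using * by simp
      qed
    qed
    also have "\<dots> \<longleftrightarrow> (\<exists>n. inverse (real (Suc n)) \<le> infdist x (- U))"
    proof
      assume "infdist x (- U) > 0"
      then obtain n where "inverse (real (Suc n)) < infdist x (- U)" using reals_Archimedean by blast
      thus "\<exists>n. inverse (real (Suc n)) \<le> infdist x (- U)" by (intro exI[of _ n]) simp
    next
      assume "\<exists>n. inverse (real (Suc n)) \<le> infdist x (- U)"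
      then obtain n where "inverse (real (Suc n)) \<le> infdist x (- U)" by blast
      moreover have "0 < inverse (real (Suc n))" by simp
      ultimately show "infdist x (- U) > 0" by linarith
    qed
    finally show "x \<in> U \<longleftrightarrow> x \<in> (\<Union>n. K n)" unfolding K_def by blast
  qed
  have "incseq K"
  proof (rule incseq_SucI)
    fix n
    have "inverse (real (Suc (Suc n))) \<le> inverse (real (Suc n))" by (simp add: field_simps)
    thus "K n \<le> K (Suc n)" unfolding K_def by (intro Collect_mono impI) (rule order_trans)
  qed
  moreover have "range K \<subseteq> sets \<mu>" using closed_K s by auto
  ultimately have "(\<lambda>n. measure \<mu> (K n)) \<longlonglongrightarrow> measure \<mu> U"
    unfolding U_eq by (intro finite_Lim_measure_incseq)
  hence "eventually (\<lambda>n. measure \<mu> (K n) > measure \<mu> U - e) sequentially"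
    by (rule order_tendstoD) (use e in simp)
  then obtain n where n: "measure \<mu> (K n) > measure \<mu> U - e"
    by (auto simp: eventually_sequentially)
  have "K n \<subseteq> U" using U_eq by blast
  moreover have "measure \<mu> (U - K n) = measure \<mu> U - measure \<mu> (K n)"
    using U closed_K \<open>K n \<subseteq> U\<close> s by (intro finite_measure_Diff) auto
  ultimately show ?thesis using that[OF closed_K[of n]] n by simp
qed

lemma closed_inner_regular:
  fixes \<mu> :: "'a::metric_space measure"
  assumes "finite_measure \<mu>" and s: "sets \<mu> = sets borel" and A: "A \<in> sets \<mu>" and e: "e > 0"
  obtains K where "closed K" "K \<subseteq> A" "measure \<mu> (A - K) < e"
proof -
  interpret finite_measure \<mu> by fact
  have sp: "space \<mu> = UNIV" using sets_eq_imp_space_eq[OF s] by simp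
  \<comment> \<open>The induction over the sigma-algebra proves \<open>?R\<close> for a set and its
    complement at once, which makes the complement case symmetric.\<close>
  let ?R = "\<lambda>A. A \<in> sets \<mu> \<and> (\<forall>e>0. \<exists>K. closed K \<and> K \<subseteq> A \<and> measure \<mu> (A - K) < e)"
  have meas: "B - K \<in> sets \<mu>" if "B \<in> sets \<mu>" "closed K" for B K
    using that s by auto
  have "A \<in> sigma_sets UNIV {U. open U}" using A s by (simp add: sets_borel)
  hence "?R A \<and> ?R (- A)"
  proof (induction rule: sigma_sets.induct)
    case (Basic U)
    hence U: "open U" by simp
    have "\<exists>K. closed K \<and> K \<subseteq> U \<and> measure \<mu> (U - K) < e" if "e > 0" for e
      by (rule closed_inner_regular_open[OF assms(1) s U that]) blast
    hence "?R U" using U s by simp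
    moreover have "?R (- U)"
    proof (intro conjI allI impI exI[of _ "- U"])
      show "- U \<in> sets \<mu>" using U s by (simp add: borel_closed closed_Compl)
    qed (use U in auto)
    ultimately show ?case by blast
  next
    case Empty
    have "?R {}" by simp
    moreover have "?R (- {})"
    proof (intro conjI allI impI exI[of _ UNIV])
      show "- {} \<in> sets \<mu>" using sets.top[of \<mu>] by (simp add: sp)
    qed auto
    ultimately show ?case by blast
  next
    case (Compl A)
    thus ?case unfolding Compl_eq_Diff_UNIV[symmetric] double_complement by blast
  next
    case (Union A)
    have As: "A i \<in> sets \<mu>" "- A i \<in> sets \<mu>" for i using Union.IH[of i] by blast+
    have UA: "(\<Union>i. A i) \<in> sets \<mu>" using As by auto
    have UA': "- (\<Union>i. A i) \<in> sets \<mu>"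
      unfolding Compl_eq_Diff_UNIV sp[symmetric] by (rule sets.compl_sets[OF UA])
    have "\<exists>K. closed K \<and> K \<subseteq> (\<Union>i. A i) \<and> measure \<mu> ((\<Union>i. A i) - K) < e" if e: "e > 0" for e
    proof -
      \<comment> \<open>A countable union of closed sets need not be closed: half of
        \<open>e\<close> pays for truncating the union to finitely many sets, the other half is
        spread geometrically over the approximations.\<close>
      have pos: "0 < e / 2 * (1/2) ^ Suc i" for i using e by simp
      have "\<forall>i. \<exists>K. closed K \<and> K \<subseteq> A i \<and> measure \<mu> (A i - K) < e / 2 * (1/2) ^ Suc i"
      proof
        fix i
        show "\<exists>K. closed K \<and> K \<subseteq> A i \<and> measure \<mu> (A i - K) < e / 2 * (1/2) ^ Suc i"
          using Union.IH[of i] pos[of i] by blast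
      qed
      from choice[OF this] obtain K where K: "\<And>i. closed (K i)" "\<And>i. K i \<subseteq> A i"
        "\<And>i. measure \<mu> (A i - K i) < e / 2 * (1/2) ^ Suc i" by blast
      have "(\<lambda>n. measure \<mu> (\<Union>i<n. A i)) \<longlonglongrightarrow> measure \<mu> (\<Union>n. \<Union>i<n. A i)"
        using As by (intro finite_Lim_measure_incseq incseq_SucI UN_mono) auto
      moreover have "(\<Union>n. \<Union>i<n. A i) = (\<Union>i. A i)" by blast
      ultimately have "(\<lambda>n. measure \<mu> (\<Union>i<n. A i)) \<longlonglongrightarrow> measure \<mu> (\<Union>i. A i)" by simp
      hence "eventually (\<lambda>n. measure \<mu> (\<Union>i<n. A i) > measure \<mu> (\<Union>i. A i) - e / 2) sequentially"
        by (rule order_tendstoD) (use e in simp)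
      then obtain n where n: "measure \<mu> (\<Union>i<n. A i) > measure \<mu> (\<Union>i. A i) - e / 2"
        by (auto simp: eventually_sequentially)
      have fA: "(\<Union>i<n. A i) \<in> sets \<mu>" using As by auto
      have "(\<Union>i. A i) - (\<Union>i<n. K i) \<subseteq> ((\<Union>i. A i) - (\<Union>i<n. A i)) \<union> (\<Union>i<n. A i - K i)" by blast
      hence "measure \<mu> ((\<Union>i. A i) - (\<Union>i<n. K i))
          \<le> measure \<mu> (((\<Union>i. A i) - (\<Union>i<n. A i)) \<union> (\<Union>i<n. A i - K i))"
        by (intro finite_measure_mono sets.Un sets.Diff[OF UA fA] sets.finite_UN meas As K(1)) simp_all
      also have "\<dots> \<le> measure \<mu> ((\<Union>i. A i) - (\<Union>i<n. A i)) + measure \<mu> (\<Union>i<n. A i - K i)"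
        by (intro measure_Un_le sets.Diff[OF UA fA] sets.finite_UN meas As K(1)) simp_all
      also have "measure \<mu> ((\<Union>i. A i) - (\<Union>i<n. A i)) = measure \<mu> (\<Union>i. A i) - measure \<mu> (\<Union>i<n. A i)"
        by (rule finite_measure_Diff[OF UA fA]) blast
      also have "measure \<mu> (\<Union>i<n. A i - K i) \<le> (\<Sum>i<n. measure \<mu> (A i - K i))"
        by (intro measure_UNION_le meas As K(1)) simp
      also have "\<dots> \<le> (\<Sum>i<n. e / 2 * (1/2) ^ Suc i)" by (intro sum_mono less_imp_le K(3))
      also have "\<dots> = e / 2 * (\<Sum>i<n. (1/2) ^ Suc i)" by (simp only: sum_distrib_left)
      also have "(\<Sum>i<n. (1/2::real) ^ Suc i) = 1 - (1/2) ^ n"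
        by (induction n) auto
      also have "e / 2 * (1 - (1/2) ^ n) \<le> e / 2" using e by simp
      finally have "measure \<mu> ((\<Union>i. A i) - (\<Union>i<n. K i)) < e" using n by simp
      moreover have "closed (\<Union>i<n. K i)" using K(1) by auto
      moreover have "(\<Union>i<n. K i) \<subseteq> (\<Union>i. A i)" using K(2) by blast
      ultimately show ?thesis by blast
    qed
    moreover have "\<exists>K. closed K \<and> K \<subseteq> - (\<Union>i. A i) \<and> measure \<mu> (- (\<Union>i. A i) - K) < e" if e: "e > 0" for e
    proof -
      \<comment> \<open>For the complement, the approximating sets are intersected; this stays
        closed without truncation, and the geometric errors sum to \<open>e / 2\<close>.\<close>
      have pos: "0 < e / 2 * (1/2) ^ Suc i" for i using e by simp
      have "\<forall>i. \<exists>K. closed K \<and> K \<subseteq> - A i \<and> measure \<mu> (- A i - K) < e / 2 * (1/2) ^ Suc i"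
      proof
        fix i
        show "\<exists>K. closed K \<and> K \<subseteq> - A i \<and> measure \<mu> (- A i - K) < e / 2 * (1/2) ^ Suc i"
          using Union.IH[of i] pos[of i] by blast
      qed
      from choice[OF this] obtain K where K: "\<And>i. closed (K i)" "\<And>i. K i \<subseteq> - A i"
        "\<And>i. measure \<mu> (- A i - K i) < e / 2 * (1/2) ^ Suc i" by blast
      have geo: "(\<lambda>i. e / 2 * (1/2) ^ Suc i) sums (e / 2)"
        using sums_mult[OF power_half_series, of "e / 2"] by simp
      have summ: "summable (\<lambda>i. measure \<mu> (- A i - K i))"
      proof (rule summable_comparison_test'[OF sums_summable[OF geo]])
        show "norm (measure \<mu> (- A i - K i)) \<le> e / 2 * (1/2) ^ Suc i" if "i \<ge> 0" for i
          unfolding real_norm_def abs_of_nonneg[OF measure_nonneg] by (rule less_imp_le[OF K(3)])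
      qed
      have "- (\<Union>i. A i) - (\<Inter>i. K i) \<subseteq> (\<Union>i. - A i - K i)" by blast
      hence "measure \<mu> (- (\<Union>i. A i) - (\<Inter>i. K i)) \<le> measure \<mu> (\<Union>i. - A i - K i)"
        by (intro finite_measure_mono) (use meas[OF As(2) K(1)] in auto)
      also have "\<dots> \<le> (\<Sum>i. measure \<mu> (- A i - K i))"
        by (rule finite_measure_subadditive_countably[OF _ summ]) (use meas[OF As(2) K(1)] in auto)
      also have "\<dots> \<le> (\<Sum>i. e / 2 * (1/2) ^ Suc i)"
        by (intro suminf_le summ sums_summable[OF geo] less_imp_le K(3))
      also have "\<dots> = e / 2" using geo by (rule sums_unique[symmetric])
      finally have "measure \<mu> (- (\<Union>i. A i) - (\<Inter>i. K i)) < e" using e by simp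
      moreover have "closed (\<Inter>i. K i)" using K(1) by auto
      moreover have "(\<Inter>i. K i) \<subseteq> - (\<Union>i. A i)" using K(2) by blast
      ultimately show ?thesis by blast
    qed
    ultimately show ?case using UA UA' by blast
  qed
  then obtain K where "closed K" "K \<subseteq> A" "measure \<mu> (A - K) < e" using e by blast
  thus ?thesis by (rule that)
qed

section \<open>Entropy and separated sets\<close>

text \<open>The continuous function \<open>infdist _ T\<close> attains its minimum on
  \<open>S\<close>, and a point outside the closed set \<open>T\<close> has positive distance to
  it.\<close>

lemma compact_closed_separated:
  fixes S T :: "'a::metric_space set"
  assumes S: "compact S" and T: "closed T" and "S \<inter> T = {}"
  shows "\<exists>d>0. \<forall>x\<in>S. \<forall>y\<in>T. d \<le> dist x y"
proof (cases "S = {} \<or> T = {}")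
  case True
  thus ?thesis by (intro exI[of _ 1]) auto
next
  case False
  obtain x where x: "x \<in> S" "\<forall>y\<in>S. infdist x T \<le> infdist y T"
    using continuous_attains_inf[OF S _ continuous_on_infdist[OF continuous_on_id], of T] False by blast
  have "infdist x T > 0" using x(1) assms False by (intro infdist_pos_not_in_closed) auto
  moreover have "infdist x T \<le> dist y z" if "y \<in> S" "z \<in> T" for y z
    using x(2) that infdist_le[OF that(2), of y] by (meson order_trans)
  ultimately show ?thesis by blast
qed

context invariant_prob begin

text \<open>A coding estimate: Gibbs' inequality compares the law of the itineraries with a mixture,
  over the points of a maximal separated set, of product weights around guessed itineraries. The
  threshold \<open>d\<close> is uniform in \<open>n\<close>, so that \<open>n\<close> can later be
  chosen after the gap length belonging to \<open>\<epsilon>\<close>.\<close>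

lemma separated_sum_ge_entropy:
  assumes X': "emeasure \<mu> X' = 1" and \<psi>: "continuous_on UNIV \<psi>" and \<gamma>: "\<gamma> > 0"
    and finP: "finite P" and P_sets: "P \<subseteq> sets \<mu>" and P: "partition_on UNIV P"
  obtains d where "d > 0" "\<And>\<epsilon> n. 0 < \<epsilon> \<Longrightarrow> \<epsilon> < d \<Longrightarrow> \<exists>E\<in>separated_sets f n (4 * \<epsilon>). E \<subseteq> X' \<and> E \<noteq> {} \<and>
      partition_entropy \<mu> (iterated_join f P n) + real n * (\<integral>x. \<psi> x \<partial>\<mu>) - real n * \<gamma>
        \<le> ln (\<Sum>e\<in>E. exp (birkhoff_sum f \<psi> n e))"
proof -
  define r where "r = card P"
  have "P \<noteq> {}" using partition_onD1[OF P] by auto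
  hence r: "r > 0" using finP by (simp add: r_def card_gt_0_iff)
  \<comment> \<open>\<open>s\<close> is the weight spread over all atoms in case the guess is wrong;
    a correct guess then costs at most \<open>\<gamma> / 3\<close>.\<close>
  define s where "s = 1 - exp (- (\<gamma> / 3))"
  have s: "0 < s" "s < 1" using \<gamma> by (simp_all add: s_def)
  have ln_s: "ln (1 - s) = - (\<gamma> / 3)" by (simp add: s_def)
  \<comment> \<open>\<open>\<kappa>\<close> is the cost of a wrong guess, and \<open>q\<close> below
    is the probability of such times that keeps the expected cost within
    \<open>\<gamma> / 3\<close>.\<close>
  define \<kappa> where "\<kappa> = - ln (s / real r)"
  have "s / real r < 1" "0 < s / real r" using s r by (simp_all add: field_simps)
  hence \<kappa>: "\<kappa> > 0" by (simp add: \<kappa>_def)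
  define q where "q = \<gamma> / (3 * \<kappa>)"
  have q: "q > 0" "q * \<kappa> = \<gamma> / 3" using \<gamma> \<kappa> by (simp_all add: q_def)
  have "\<forall>A\<in>P. \<exists>K. closed K \<and> K \<subseteq> A \<and> prob (A - K) < q / real r"
  proof
    fix A assume "A \<in> P"
    hence "A \<in> sets \<mu>" using P_sets by blast
    moreover have "q / real r > 0" using q r by simp
    ultimately obtain K where "closed K" "K \<subseteq> A" "prob (A - K) < q / real r"
      by (rule closed_inner_regular[OF finite_measure_axioms sets_eq])
    thus "\<exists>K. closed K \<and> K \<subseteq> A \<and> prob (A - K) < q / real r" by blast
  qed
  from bchoice[OF this] obtain K where K: "\<And>A. A \<in> P \<Longrightarrow> closed (K A)" "\<And>A. A \<in> P \<Longrightarrow> K A \<subseteq> A"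
    "\<And>A. A \<in> P \<Longrightarrow> prob (A - K A) < q / real r" by blast
  define W where "W = (\<Union>A\<in>P. K A)"
  have closed_W: "closed W" unfolding W_def using finP K(1) by (intro closed_UN) auto
  have W_sets: "- W \<in> sets \<mu>" using closed_W sets_eq by (simp add: open_Compl)
  have prob_W: "prob (- W) \<le> q"
  proof -
    have "- W \<subseteq> (\<Union>A\<in>P. A - K A)"
    proof
      fix x assume "x \<in> - W"
      moreover obtain A where "A \<in> P" "x \<in> A" using partition_onD1[OF P] by blast
      ultimately show "x \<in> (\<Union>A\<in>P. A - K A)" unfolding W_def by blast
    qed
    moreover have meas: "A - K A \<in> sets \<mu>" if "A \<in> P" for A
    proof (rule sets.Diff)
      show "A \<in> sets \<mu>" using that P_sets by blast
      show "K A \<in> sets \<mu>" using K(1)[OF that] sets_eq by simp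
    qed
    ultimately have "prob (- W) \<le> prob (\<Union>A\<in>P. A - K A)"
      by (intro finite_measure_mono sets.finite_UN finP)
    also have "\<dots> \<le> (\<Sum>A\<in>P. prob (A - K A))" by (rule measure_UNION_le[OF finP meas])
    also have "\<dots> \<le> of_nat (card P) * (q / real r)"
      by (rule sum_bounded_above) (rule less_imp_le[OF K(3)])
    also have "\<dots> = q" using r by (simp add: r_def)
    finally show ?thesis .
  qed
  have "\<forall>AB\<in>{(A, B) \<in> P \<times> P. A \<noteq> B}. \<exists>d>0. \<forall>x\<in>K (fst AB). \<forall>y\<in>K (snd AB). d \<le> dist x y"
  proof
    fix AB assume "AB \<in> {(A, B) \<in> P \<times> P. A \<noteq> B}"
    then obtain A B where AB: "AB = (A, B)" "A \<in> P" "B \<in> P" "A \<noteq> B" by blast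
    have "A \<inter> B = {}" using partition_onD2[OF P] AB by (auto simp: disjoint_def)
    hence "K A \<inter> K B = {}" using K(2) AB by blast
    moreover have "compact (K A)" using compact_Int_closed[OF compact_UNIV K(1)[OF AB(2)]] by simp
    ultimately obtain d where "d > 0" "\<forall>x\<in>K A. \<forall>y\<in>K B. d \<le> dist x y"
      using compact_closed_separated[OF _ K(1)[OF AB(3)]] by blast
    thus "\<exists>d>0. \<forall>x\<in>K (fst AB). \<forall>y\<in>K (snd AB). d \<le> dist x y" unfolding AB(1) by auto
  qed
  from bchoice[OF this] obtain D where D0: "\<forall>AB\<in>{(A, B) \<in> P \<times> P. A \<noteq> B}.
    D AB > 0 \<and> (\<forall>x\<in>K (fst AB). \<forall>y\<in>K (snd AB). D AB \<le> dist x y)" ..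
  have D: "\<And>A B. A \<in> P \<Longrightarrow> B \<in> P \<Longrightarrow> A \<noteq> B \<Longrightarrow> D (A, B) > 0"
      "\<And>A B x y. A \<in> P \<Longrightarrow> B \<in> P \<Longrightarrow> A \<noteq> B \<Longrightarrow> x \<in> K A \<Longrightarrow> y \<in> K B \<Longrightarrow> D (A, B) \<le> dist x y"
    using D0 by (simp_all add: case_prod_unfold)
  \<comment> \<open>Inserting 1 keeps the minimum defined when \<open>P\<close> has only one
    atom.\<close>
  define d1 where "d1 = Min (insert 1 (D ` {(A, B) \<in> P \<times> P. A \<noteq> B}))"
  have fin_pairs: "finite {(A, B) \<in> P \<times> P. A \<noteq> B}"
    by (rule finite_subset[OF _ finite_cartesian_product[OF finP finP]]) blast
  have d1: "d1 > 0" unfolding d1_def using fin_pairs D(1) by (subst Min_gr_iff) auto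
  have d1_le: "d1 \<le> dist x y" if "A \<in> P" "B \<in> P" "A \<noteq> B" "x \<in> K A" "y \<in> K B" for A B x y
  proof -
    have "d1 \<le> D (A, B)" unfolding d1_def using fin_pairs that by (intro Min_le) auto
    also have "\<dots> \<le> dist x y" by (rule D(2)[OF that])
    finally show ?thesis .
  qed
  have "\<gamma> / 3 > 0" using \<gamma> by simp
  then obtain d2 where d2: "d2 > 0" "\<And>x y. dist x y \<le> d2 \<Longrightarrow> \<bar>\<psi> x - \<psi> y\<bar> \<le> \<gamma> / 3"
    using uniform_modulus[OF \<psi>] by blast
  show ?thesis
  \<comment> \<open>With \<open>8 * \<epsilon> < d1\<close> no point is within
    \<open>4 * \<epsilon>\<close> of two of the sets \<open>K A\<close>, so guesses are unambiguous;
    with \<open>4 * \<epsilon> < d2\<close> the potential varies by at most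
    \<open>\<gamma> / 3\<close> between a point and its representative.\<close>
  proof (rule that[of "min (d1 / 8) (d2 / 4)"])
    show "min (d1 / 8) (d2 / 4) > 0" using d1 d2(1) by simp
    fix \<epsilon> :: real and n assume \<epsilon>: "0 < \<epsilon>" "\<epsilon> < min (d1 / 8) (d2 / 4)"
    have "4 * \<epsilon> > 0" using \<epsilon> by simp
    then obtain E where E: "E \<in> separated_sets f n (4 * \<epsilon>)" "E \<subseteq> X'"
      "\<And>y. y \<in> X' \<Longrightarrow> \<exists>e\<in>E. \<forall>i<n. dist ((f ^^ i) e) ((f ^^ i) y) \<le> 4 * \<epsilon>"
      using maximal_separated_set[of "4 * \<epsilon>" n X'] by blast
    have finE: "finite E" using E(1) by (simp add: separated_sets_def)
    have "X' \<noteq> {}" using X' by auto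
    hence neE: "E \<noteq> {}" using E(3) by blast
    define S where "S = birkhoff_sum f \<psi> n"
    define Zs where "Zs = (\<Sum>e\<in>E. exp (S e))"
    have Zs: "Zs > 0" unfolding Zs_def by (rule sum_pos[OF finE neE]) simp
    define near where "near e i A \<longleftrightarrow> A \<in> P \<and> (\<exists>k\<in>K A. dist ((f ^^ i) e) k \<le> 4 * \<epsilon>)" for e i A
    \<comment> \<open>If no atom is near, the guess is arbitrary; it is used only at times when
      \<open>y\<close> visits \<open>W\<close>, where a near atom exists.\<close>
    define guess where "guess e i = (SOME A. near e i A)" for e i
    have guess: "guess e i = A" if "near e i A" for e i A
    proof (rule ccontr)
      assume ne: "guess e i \<noteq> A"
      have "near e i (guess e i)" unfolding guess_def by (rule someI[of _ A]) (rule that)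
      with that obtain x y where xy: "x \<in> K (guess e i)" "y \<in> K A" "guess e i \<in> P" "A \<in> P"
        "dist ((f ^^ i) e) x \<le> 4 * \<epsilon>" "dist ((f ^^ i) e) y \<le> 4 * \<epsilon>"
        unfolding near_def by blast
      have "d1 \<le> dist x y" using d1_le xy ne by blast
      also have "\<dots> \<le> dist ((f ^^ i) e) x + dist ((f ^^ i) e) y" by (rule dist_triangle3)
      finally show False using xy(5,6) \<epsilon> by simp
    qed
    \<comment> \<open>The uniform part keeps every weight positive, so all logarithms below are
      finite. An arbitrary guess may lie outside \<open>P\<close>, so the total is only at most
      1.\<close>
    define w where "w e i A = (if A = guess e i then 1 - s else 0) + s / real r" for e i A
    have w_lower: "s / real r \<le> w e i A" for e i A using s by (simp add: w_def)
    have w_pos: "w e i A > 0" for e i A using w_lower[of e i A] \<open>0 < s / real r\<close> by linarith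
    have w_sum: "(\<Sum>A\<in>P. w e i A) \<le> 1" for e i
    proof -
      have "(\<Sum>A\<in>P. w e i A) = (\<Sum>A\<in>P. if A = guess e i then 1 - s else 0) + s"
        unfolding w_def sum.distrib using r by (simp add: r_def)
      also have "(\<Sum>A\<in>P. if A = guess e i then 1 - s else 0) \<le> 1 - s"
        using s finP by (simp add: sum.delta)
      finally show ?thesis by simp
    qed
    let ?N = "PiE {..<n} (\<lambda>_. P)"
    define g where "g e = exp (S e) / Zs" for e
    have g_pos: "g e > 0" for e using Zs by (simp add: g_def)
    have g_sum: "(\<Sum>e\<in>E. g e) = 1"
      using Zs unfolding g_def sum_divide_distrib[symmetric] Zs_def[symmetric] by simp
    define Wt where "Wt a = (\<Sum>e\<in>E. g e * (\<Prod>i<n. w e i (a i)))" for a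
    have term_pos: "0 < g e * (\<Prod>i<n. w e i (a i))" for e a
      by (intro mult_pos_pos g_pos prod_pos) (simp add: w_pos)
    have Wt_pos: "Wt a > 0" for a unfolding Wt_def by (rule sum_pos[OF finE neE term_pos])
    have Wt_sum: "(\<Sum>a\<in>?N. Wt a) \<le> 1"
    proof -
      have "(\<Sum>a\<in>?N. Wt a) = (\<Sum>e\<in>E. g e * (\<Sum>a\<in>?N. \<Prod>i<n. w e i (a i)))"
        unfolding Wt_def by (subst sum.swap) (simp add: sum_distrib_left)
      also have "\<dots> = (\<Sum>e\<in>E. g e * (\<Prod>i<n. \<Sum>A\<in>P. w e i A))"
        by (subst prod_sum_PiE) (use finP in auto)
      also have "\<dots> \<le> (\<Sum>e\<in>E. g e * 1)"
      proof (intro sum_mono mult_left_mono prod_le_1 conjI)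
        show "0 \<le> (\<Sum>A\<in>P. w e i A)" for e i by (intro sum_nonneg less_imp_le w_pos)
      qed (use w_sum g_pos in \<open>auto intro: less_imp_le\<close>)
      finally show ?thesis using g_sum by simp
    qed
    have cells: "finite ?N" "disjoint_family_on (itinerary_cell f n) ?N"
      "(\<Union>a\<in>?N. itinerary_cell f n a) = space \<mu>"
      by (rule itinerary_cells_partition[OF finP P_sets P])+
    have cell_sets: "itinerary_cell f n a \<in> sets \<mu>" if "a \<in> ?N" for a
      by (rule itinerary_cell_sets[OF finP P_sets P that])
    define p where "p a = prob (itinerary_cell f n a)" for a
    have p_sum: "(\<Sum>a\<in>?N. p a) = 1"
      unfolding p_def using sum_prob_inter_partition[OF cells(1) cell_sets cells(2,3) sets.top]
      by (simp add: space_eq prob_space[unfolded space_eq])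
    have gibbs: "(\<Sum>a\<in>?N. p a * ln (Wt a)) \<le> (\<Sum>a\<in>?N. p a * ln (p a))"
    proof (rule gibbs_inequality[OF cells(1)])
      show "(\<Sum>a\<in>?N. Wt a) \<le> (\<Sum>a\<in>?N. p a)" using Wt_sum p_sum by simp
    qed (use Wt_pos in \<open>auto simp: p_def intro: less_imp_le\<close>)
    \<comment> \<open>A lower bound for \<open>ln (Wt a)\<close> on the cell of \<open>a\<close>
      that depends on \<open>y\<close> only through Birkhoff sums, so its integral follows from
      invariance alone.\<close>
    define b where "b y = S y - real n * (\<gamma> / 3) - ln Zs - real n * (\<gamma> / 3)
        - \<kappa> * birkhoff_sum f (indicator (- W)) n y" for y
    have key: "b y \<le> ln (Wt a)" if y: "y \<in> X'" "y \<in> itinerary_cell f n a" and a: "a \<in> ?N" for y a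
    proof -
      obtain e where e: "e \<in> E" "\<And>i. i < n \<Longrightarrow> dist ((f ^^ i) e) ((f ^^ i) y) \<le> 4 * \<epsilon>"
        using E(3)[OF y(1)] by blast
      have "\<bar>S e - S y\<bar> \<le> real n * (\<gamma> / 3)" unfolding S_def
      proof (rule birkhoff_sum_diff_le)
        fix i assume "i < n"
        thus "\<bar>\<psi> ((f ^^ i) e) - \<psi> ((f ^^ i) y)\<bar> \<le> \<gamma> / 3" using e(2)[of i] \<epsilon> by (intro d2(2)) simp
      qed
      moreover have "(\<Sum>i<n. - (\<gamma> / 3) - \<kappa> * indicator (- W) ((f ^^ i) y)) \<le> (\<Sum>i<n. ln (w e i (a i)))"
      proof (rule sum_mono)
        fix i assume "i \<in> {..<n}"
        hence i: "i < n" "(f ^^ i) y \<in> a i" "a i \<in> P" using y(2) a by (auto simp: mem_itinerary_cell)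
        show "- (\<gamma> / 3) - \<kappa> * indicator (- W) ((f ^^ i) y) \<le> ln (w e i (a i))"
        proof (cases "(f ^^ i) y \<in> W")
          case True
          then obtain A where A: "A \<in> P" "(f ^^ i) y \<in> K A" by (auto simp: W_def)
          hence "A = a i" using partition_onD2[OF P] K(2)[OF A(1)] i(2,3) by (auto simp: disjoint_def)
          hence "near e i (a i)" unfolding near_def using A e(2)[OF i(1)] by blast
          hence "1 - s \<le> w e i (a i)" using guess[of e i "a i"] \<open>0 < s / real r\<close> by (simp add: w_def)
          hence "ln (1 - s) \<le> ln (w e i (a i))" using s by (intro ln_mono) auto
          thus ?thesis using True by (simp add: ln_s)
        next
          case False
          have "ln (s / real r) \<le> ln (w e i (a i))"
            using w_lower \<open>0 < s / real r\<close> w_pos by (intro ln_mono) auto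
          thus ?thesis using False \<gamma> by (simp add: \<kappa>_def)
        qed
      qed
      moreover have "(\<Sum>i<n. - (\<gamma> / 3) - \<kappa> * indicator (- W) ((f ^^ i) y))
          = - real n * (\<gamma> / 3) - \<kappa> * birkhoff_sum f (indicator (- W)) n y"
        by (simp add: sum_subtractf sum_distrib_left birkhoff_sum_def)
      moreover have "ln (g e * (\<Prod>i<n. w e i (a i))) = S e - ln Zs + (\<Sum>i<n. ln (w e i (a i)))"
      proof -
        have "ln (g e * (\<Prod>i<n. w e i (a i))) = ln (g e) + ln (\<Prod>i<n. w e i (a i))"
          by (intro ln_mult_pos g_pos prod_pos) (simp add: w_pos)
        also have "ln (g e) = S e - ln Zs" using Zs by (simp add: g_def ln_div)
        also have "ln (\<Prod>i<n. w e i (a i)) = (\<Sum>i<n. ln (w e i (a i)))"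
          by (intro ln_prod) (simp_all add: less_imp_neq[OF w_pos, symmetric])
        finally show ?thesis .
      qed
      moreover have "ln (g e * (\<Prod>i<n. w e i (a i))) \<le> ln (Wt a)"
      proof (rule ln_mono[OF _ term_pos])
        show "g e * (\<Prod>i<n. w e i (a i)) \<le> Wt a" unfolding Wt_def
          by (rule member_le_sum[OF e(1) less_imp_le[OF term_pos] finE])
      qed
      ultimately show ?thesis unfolding b_def by linarith
    qed
    have ind: "integrable \<mu> (indicator (- W) :: 'a \<Rightarrow> real)"
      using W_sets by (intro integrable_real_indicator) (simp_all add: emeasure_eq_measure)
    note intS = integral_birkhoff_sum[OF continuous_integrable[OF \<psi>], of n]
      and intW = integral_birkhoff_sum[OF ind, of n]
    have b_int: "integrable \<mu> b" unfolding b_def S_def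
      by (intro Bochner_Integration.integrable_diff integrable_mult_right intS intW) simp_all
    have "(\<integral>y. b y \<partial>\<mu>) = real n * (\<integral>x. \<psi> x \<partial>\<mu>) - real n * (\<gamma> / 3) - ln Zs - real n * (\<gamma> / 3)
        - \<kappa> * (real n * prob (- W))"
      unfolding b_def S_def
      by (simp add: intS intW prob_space[unfolded space_eq] space_eq W_sets)
    \<comment> \<open>By invariance the expected number of visits to the complement of
      \<open>W\<close> before time \<open>n\<close> is \<open>n * prob (- W)\<close>.\<close>
    moreover have "\<kappa> * (real n * prob (- W)) \<le> real n * (\<gamma> / 3)"
    proof -
      have "real n * (\<kappa> * prob (- W)) \<le> real n * (\<kappa> * q)"
        using prob_W \<kappa> by (intro mult_left_mono) auto
      also have "\<kappa> * q = \<gamma> / 3" using q(2) by (simp add: mult.commute)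
      finally show ?thesis by (simp add: mult.left_commute)
    qed
    moreover have "real n * \<gamma> = real n * (\<gamma> / 3) + real n * (\<gamma> / 3) + real n * (\<gamma> / 3)"
      by (simp add: algebra_simps)
    ultimately have b_lower: "real n * (\<integral>x. \<psi> x \<partial>\<mu>) - ln Zs - real n * \<gamma> \<le> (\<integral>y. b y \<partial>\<mu>)"
      by linarith
    \<comment> \<open>\<open>F y\<close> is \<open>ln (Wt a)\<close> for the itinerary
      \<open>a\<close> of \<open>y\<close>, written with indicators to make its integral a sum over
      words.\<close>
    define F where "F y = (\<Sum>a\<in>?N. indicator (itinerary_cell f n a) y * ln (Wt a))" for y
    have ind_cell: "integrable \<mu> (indicator (itinerary_cell f n a) :: 'a \<Rightarrow> real)" if "a \<in> ?N" for a
      using cell_sets[OF that] by (intro integrable_real_indicator) (simp_all add: emeasure_eq_measure)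
    have F_int: "integrable \<mu> F" unfolding F_def
      by (intro Bochner_Integration.integrable_sum integrable_mult_left ind_cell)
    have F_eq: "(\<integral>y. F y \<partial>\<mu>) = (\<Sum>a\<in>?N. p a * ln (Wt a))"
    proof -
      have "(\<integral>y. F y \<partial>\<mu>) = (\<Sum>a\<in>?N. \<integral>y. indicator (itinerary_cell f n a) y * ln (Wt a) \<partial>\<mu>)"
        unfolding F_def by (intro Bochner_Integration.integral_sum integrable_mult_left ind_cell)
      also have "\<dots> = (\<Sum>a\<in>?N. p a * ln (Wt a))"
        by (intro sum.cong refl) (simp add: p_def cell_sets)
      finally show ?thesis .
    qed
    have X'_sets: "X' \<in> sets \<mu>" using X' emeasure_notin_sets[of X' \<mu>] by force
    have "prob X' = 1" using X' by (simp add: measure_def)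
    hence ae: "AE y in \<mu>. y \<in> X'" using prob_eq_1[OF X'_sets] by simp
    have "(\<integral>y. b y \<partial>\<mu>) \<le> (\<integral>y. F y \<partial>\<mu>)"
    proof (rule integral_mono_AE[OF b_int F_int])
      show "AE y in \<mu>. b y \<le> F y"
        using ae
      proof eventually_elim
        fix y assume y: "y \<in> X'"
        obtain a where a: "a \<in> ?N" "y \<in> itinerary_cell f n a" by (rule itinerary_cell_exists[OF P])
        have "F y = (\<Sum>a'\<in>?N. if a' = a then ln (Wt a) else 0)" unfolding F_def
        proof (rule sum.cong[OF refl])
          fix a' assume a': "a' \<in> ?N"
          show "indicator (itinerary_cell f n a') y * ln (Wt a') = (if a' = a then ln (Wt a) else 0)"
          proof (cases "y \<in> itinerary_cell f n a'")
            case True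
            hence "a' = a" using itinerary_cell_unique[OF P a' a(1) _ a(2)] by blast
            thus ?thesis using True by simp
          next
            case False
            hence "a' \<noteq> a" using a(2) by blast
            thus ?thesis using False by simp
          qed
        qed
        also have "\<dots> = ln (Wt a)" using a(1) cells(1) by simp
        finally show "b y \<le> F y" using key[OF y a(2) a(1)] by simp
      qed
    qed
    with b_lower F_eq gibbs have "real n * (\<integral>x. \<psi> x \<partial>\<mu>) - ln Zs - real n * \<gamma> \<le> (\<Sum>a\<in>?N. p a * ln (p a))"
      by linarith
    hence "partition_entropy \<mu> (iterated_join f P n) + real n * (\<integral>x. \<psi> x \<partial>\<mu>) - real n * \<gamma> \<le> ln Zs"
      unfolding partition_entropy_iterated_join[OF finP P_sets P] p_def by linarith
    thus "\<exists>E\<in>separated_sets f n (4 * \<epsilon>). E \<subseteq> X' \<and> E \<noteq> {} \<and>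
      partition_entropy \<mu> (iterated_join f P n) + real n * (\<integral>x. \<psi> x \<partial>\<mu>) - real n * \<gamma>
        \<le> ln (\<Sum>e\<in>E. exp (birkhoff_sum f \<psi> n e))"
      using E(1,2) neE unfolding Zs_def S_def by blast
  qed
qed

end

section \<open>Oscillating windows\<close>

text \<open>By invariance the Birkhoff sum has integral \<open>n\<close> times that of
  \<open>\<phi>\<close>; it cannot stay at or below \<open>n * c\<close> almost everywhere when
  \<open>c\<close> is smaller than the mean.\<close>

lemma (in invariant_prob) exists_birkhoff_sum_ge:
  assumes X': "emeasure \<mu> X' = 1" and \<phi>: "continuous_on UNIV \<phi>" and n: "n > 0"
    and c: "c < (\<integral>x. \<phi> x \<partial>\<mu>)"
  obtains y where "y \<in> X'" "real n * c \<le> birkhoff_sum f \<phi> n y"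
proof (rule ccontr)
  assume "\<not> thesis"
  hence less: "birkhoff_sum f \<phi> n y \<le> real n * c" if "y \<in> X'" for y
    using that \<open>\<And>y. y \<in> X' \<Longrightarrow> real n * c \<le> birkhoff_sum f \<phi> n y \<Longrightarrow> thesis\<close>
    by (metis linear)
  note int = integral_birkhoff_sum[OF continuous_integrable[OF \<phi>], of n]
  have X'_sets: "X' \<in> sets \<mu>" using X' emeasure_notin_sets[of X' \<mu>] by force
  have "prob X' = 1" using X' by (simp add: measure_def)
  hence "AE y in \<mu>. y \<in> X'" using prob_eq_1[OF X'_sets] by simp
  hence "AE y in \<mu>. birkhoff_sum f \<phi> n y \<le> real n * c" by eventually_elim (rule less)
  hence "(\<integral>y. birkhoff_sum f \<phi> n y \<partial>\<mu>) \<le> (\<integral>y. real n * c \<partial>\<mu>)"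
    by (intro integral_mono_AE int) simp_all
  hence "real n * (\<integral>x. \<phi> x \<partial>\<mu>) \<le> real n * c" by (simp add: int(2) prob_space)
  thus False using n c by simp
qed

lemma (in invariant_prob) exists_birkhoff_sum_le:
  assumes X': "emeasure \<mu> X' = 1" and \<phi>: "continuous_on UNIV \<phi>" and n: "n > 0"
    and c: "(\<integral>x. \<phi> x \<partial>\<mu>) < c"
  obtains y where "y \<in> X'" "birkhoff_sum f \<phi> n y \<le> real n * c"
proof -
  have "continuous_on UNIV (\<lambda>x. - \<phi> x)" using \<phi> by (rule continuous_on_minus)
  moreover have "- c < (\<integral>x. - \<phi> x \<partial>\<mu>)" using c by simp
  ultimately obtain y where y: "y \<in> X'" "real n * (- c) \<le> birkhoff_sum f (\<lambda>x. - \<phi> x) n y"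
    using exists_birkhoff_sum_ge[OF X' _ n] by blast
  have "birkhoff_sum f (\<lambda>x. - \<phi> x) n y = - birkhoff_sum f \<phi> n y"
    by (simp add: birkhoff_sum_def sum_negf)
  with y show ?thesis by (intro that[of y]) simp_all
qed

text \<open>Window \<open>k\<close> makes up the fixed fraction \<open>1 / (q + 1)\<close> of the
  time elapsed at its end: long enough to influence averages forever, yet sparse for large
  \<open>q\<close>.\<close>

definition window :: "nat \<Rightarrow> nat \<Rightarrow> nat set" where
  "window q k = {q * 4 ^ k..<Suc q * 4 ^ k}"

text \<open>Window \<open>k\<close> ends by \<open>(q + 1) * 4 ^ k \<le> q * 4 ^ Suc k\<close>,
  where the next one starts; this uses \<open>q > 0\<close>.\<close>

lemma window_disjoint:
  assumes q: "q > 0" and j: "j \<in> window q k" "j \<in> window q l"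
  shows "k = l"
proof -
  have "\<not> k < l" if "j \<in> window q k" "j \<in> window q l" for k l
  proof
    assume "k < l"
    have "Suc q * 4 ^ k \<le> (4 * q) * 4 ^ k" using q by (intro mult_le_mono1) simp
    also have "\<dots> = q * 4 ^ Suc k" by simp
    also have "\<dots> \<le> q * 4 ^ l" using \<open>k < l\<close> by (intro mult_le_mono2 power_increasing) auto
    finally show False using that by (simp add: window_def)
  qed
  thus ?thesis using j by (meson nat_neq_iff)
qed

text \<open>If \<open>K\<close> is the last window starting before \<open>r\<close>, the lengths up
  to \<open>K\<close> form a geometric sum of at most \<open>2 * 4 ^ K\<close>, and
  \<open>q * 4 ^ K < r\<close>.\<close>

lemma card_windows_le: "q * card ({..<r} \<inter> (\<Union>k. window q k)) \<le> 2 * r"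
proof (cases "\<forall>k. r \<le> q * 4 ^ k")
  case True
  have "{..<r} \<inter> (\<Union>k. window q k) = {}"
  proof (rule equals0I)
    fix j assume "j \<in> {..<r} \<inter> (\<Union>k. window q k)"
    then obtain k where "j < r" "q * 4 ^ k \<le> j" by (auto simp: window_def)
    thus False using True[rule_format, of k] by simp
  qed
  thus ?thesis by simp
next
  case False
  show ?thesis
  proof (cases "q = 0")
    case q: False
    let ?P = "\<lambda>k. q * 4 ^ k < r"
    have bound: "k \<le> r" if "?P k" for k
    proof -
      have "k < 4 ^ k" by (rule power_gt_expt) simp
      also have "\<dots> \<le> q * 4 ^ k" using q by simp
      finally show ?thesis using that by simp
    qed
    define K where "K = (GREATEST k. ?P k)"
    obtain k0 where k0: "?P k0" using False by (auto simp: not_le)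
    have K: "?P K" unfolding K_def by (rule GreatestI_nat[of ?P k0 r]) (use k0 bound in auto)
    have K_max: "k \<le> K" if "?P k" for k
      unfolding K_def by (rule Greatest_le_nat[of ?P k r]) (use that bound in auto)
    have sum4: "(\<Sum>k\<le>N. 4 ^ k) \<le> 2 * (4::nat) ^ N" for N by (induction N) auto
    have "{..<r} \<inter> (\<Union>k. window q k) \<subseteq> (\<Union>k\<le>K. window q k)"
    proof
      fix j assume "j \<in> {..<r} \<inter> (\<Union>k. window q k)"
      then obtain k where k: "j < r" "j \<in> window q k" by blast
      hence "?P k" by (simp add: window_def)
      thus "j \<in> (\<Union>k\<le>K. window q k)" using k K_max by blast
    qed
    hence "card ({..<r} \<inter> (\<Union>k. window q k)) \<le> card (\<Union>k\<le>K. window q k)"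
      by (intro card_mono) (auto simp: window_def)
    also have "\<dots> \<le> (\<Sum>k\<le>K. card (window q k))" by (rule card_UN_le) simp
    also have "\<dots> = (\<Sum>k\<le>K. 4 ^ k)" by (simp add: window_def)
    also have "\<dots> \<le> 2 * 4 ^ K" by (rule sum4)
    finally have "q * card ({..<r} \<inter> (\<Union>k. window q k)) \<le> 2 * (q * 4 ^ K)" by simp
    thus ?thesis using K by linarith
  qed simp
qed

text \<open>The average over a window is a combination of the Birkhoff averages at its two ends with
  coefficients independent of \<open>k\<close>. Convergent averages would therefore make the window
  averages converge, against the gap between even and odd windows.\<close>

lemma irregular_if_oscillating_windows:
  assumes B: "\<And>x. \<bar>\<phi> x\<bar> \<le> B" and q: "q > 0" and n: "n > 0"
    and hi: "\<And>k j p. even k \<Longrightarrow> j \<in> window q k \<Longrightarrow> p < n \<Longrightarrow>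
      \<bar>\<phi> ((f ^^ (p + j * (n + m))) z) - \<phi> ((f ^^ p) y)\<bar> \<le> v"
    and lo: "\<And>k j p. odd k \<Longrightarrow> j \<in> window q k \<Longrightarrow> p < n \<Longrightarrow>
      \<bar>\<phi> ((f ^^ (p + j * (n + m))) z) - \<phi> ((f ^^ p) y')\<bar> \<le> v"
    and gap: "birkhoff_sum f \<phi> n y' + 2 * (real n * v + real m * B) < birkhoff_sum f \<phi> n y"
  shows "z \<in> irregular_set f \<phi>"
proof (rule ccontr)
  define L where "L = n + m"
  have L: "L > 0" using n by (simp add: L_def)
  define S where "S = birkhoff_sum f \<phi>"
  define a where "a N = S N z / real N" for N
  assume "z \<notin> irregular_set f \<phi>"
  then obtain s where s: "a \<longlonglongrightarrow> s"
    unfolding irregular_set_def a_def S_def convergent_def by blast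
  define err where "err = real n * v + real m * B"
  \<comment> \<open>The window sum per block rather than per unit of time, directly comparable with
    the sums \<open>S n y\<close> and \<open>S n y'\<close> over one block.\<close>
  define u where "u k = S (4 ^ k * L) ((f ^^ (q * 4 ^ k * L)) z) / real (4 ^ k)" for k
  have win: "\<bar>S (4 ^ k * L) ((f ^^ (q * 4 ^ k * L)) z) - real (4 ^ k) * S n w\<bar> \<le> real (4 ^ k) * err"
    if "\<And>j p. j \<in> window q k \<Longrightarrow> p < n \<Longrightarrow>
      \<bar>\<phi> ((f ^^ (p + j * (n + m))) z) - \<phi> ((f ^^ p) w)\<bar> \<le> v" for k w
  proof -
    have "\<bar>birkhoff_sum f \<phi> (4 ^ k * (n + m)) ((f ^^ (q * 4 ^ k * L)) z) - (\<Sum>j<(4::nat) ^ k. birkhoff_sum f \<phi> n w)\<bar>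
      \<le> real (4 ^ k) * (real n * v + real m * B)"
    proof (rule birkhoff_sum_shadow[OF B, where \<omega> = "\<lambda>_. w"])
      fix j p :: nat assume jp: "j < 4 ^ k" "p < n"
      have "q * 4 ^ k + j \<in> window q k" using jp(1) by (simp add: window_def)
      from that[OF this jp(2)]
      have "\<bar>\<phi> ((f ^^ (p + (q * 4 ^ k + j) * (n + m))) z) - \<phi> ((f ^^ p) w)\<bar> \<le> v" .
      moreover have "p + (q * 4 ^ k + j) * (n + m) = (p + j * (n + m)) + q * 4 ^ k * L"
        unfolding L_def by (simp only: add_mult_distrib add.assoc add.commute add.left_commute)
      ultimately show "\<bar>\<phi> ((f ^^ (p + j * (n + m))) ((f ^^ (q * 4 ^ k * L)) z)) - \<phi> ((f ^^ p) w)\<bar> \<le> v"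
        by (simp only: funpow_add o_apply)
    qed
    thus ?thesis unfolding S_def L_def err_def by simp
  qed
  have u_hi: "S n y - err \<le> u k" if "even k" for k
  proof -
    have abs: "\<bar>S (4 ^ k * L) ((f ^^ (q * 4 ^ k * L)) z) - real (4 ^ k) * S n y\<bar> \<le> real (4 ^ k) * err"
      by (rule win) (rule hi[OF that])
    have "real (4 ^ k) * (S n y - err) \<le> S (4 ^ k * L) ((f ^^ (q * 4 ^ k * L)) z)"
      using abs by (simp add: right_diff_distrib abs_le_iff)
    thus ?thesis unfolding u_def by (simp add: pos_le_divide_eq mult.commute)
  qed
  have u_lo: "u k \<le> S n y' + err" if "odd k" for k
  proof -
    have abs: "\<bar>S (4 ^ k * L) ((f ^^ (q * 4 ^ k * L)) z) - real (4 ^ k) * S n y'\<bar> \<le> real (4 ^ k) * err"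
      by (rule win) (rule lo[OF that])
    have "S (4 ^ k * L) ((f ^^ (q * 4 ^ k * L)) z) \<le> real (4 ^ k) * (S n y' + err)"
      using abs by (simp add: distrib_left abs_le_iff)
    thus ?thesis unfolding u_def by (simp add: pos_divide_le_eq mult.commute)
  qed
  have SN: "S N z = real N * a N" if "N > 0" for N using that by (simp add: a_def)
  have u_eq: "u k = real L * ((real q + 1) * a (Suc q * L * 4 ^ k) - real q * a (q * L * 4 ^ k))" for k
  proof -
    have e: "q * 4 ^ k * L = q * L * 4 ^ k" by simp
    have "Suc q * L * 4 ^ k = q * 4 ^ k * L + 4 ^ k * L" by (simp add: algebra_simps)
    hence "S (Suc q * L * 4 ^ k) z = S (q * 4 ^ k * L) z + S (4 ^ k * L) ((f ^^ (q * 4 ^ k * L)) z)"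
      unfolding S_def by (simp only: birkhoff_sum_add)
    hence "S (4 ^ k * L) ((f ^^ (q * 4 ^ k * L)) z) = S (Suc q * L * 4 ^ k) z - S (q * L * 4 ^ k) z"
      unfolding e by linarith
    moreover have "S (Suc q * L * 4 ^ k) z = (real q + 1) * real L * real (4 ^ k) * a (Suc q * L * 4 ^ k)"
      using SN[of "Suc q * L * 4 ^ k"] L by (simp add: algebra_simps)
    moreover have "S (q * L * 4 ^ k) z = real q * real L * real (4 ^ k) * a (q * L * 4 ^ k)"
      using SN[of "q * L * 4 ^ k"] L q by simp
    ultimately show ?thesis unfolding u_def by (simp add: field_simps)
  qed
  have sub: "(\<lambda>k. a (c * 4 ^ k)) \<longlonglongrightarrow> s" if "c > 0" for c
  proof -
    have "strict_mono (\<lambda>k. c * (4::nat) ^ k)"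
      using that by (intro strict_monoI_Suc) simp
    from LIMSEQ_subseq_LIMSEQ[OF s this] show ?thesis by (simp add: o_def)
  qed
  have u_lim: "u \<longlonglongrightarrow> real L * ((real q + 1) * s - real q * s)"
    unfolding u_eq using sub[of "Suc q * L"] sub[of "q * L"] q L by (intro tendsto_intros) simp_all
  define t where "t = real L * ((real q + 1) * s - real q * s)"
  have "strict_mono (\<lambda>k::nat. 2 * k)" "strict_mono (\<lambda>k::nat. 2 * k + 1)"
    by (simp_all add: strict_mono_def)
  from this[THEN LIMSEQ_subseq_LIMSEQ[OF u_lim]]
  have "(\<lambda>k. u (2 * k)) \<longlonglongrightarrow> t" "(\<lambda>k. u (2 * k + 1)) \<longlonglongrightarrow> t" by (simp_all add: o_def t_def)
  hence "S n y - err \<le> t" "t \<le> S n y' + err"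
    using LIMSEQ_le_const[of "\<lambda>k. u (2 * k)" t "S n y - err"] u_hi
      LIMSEQ_le_const2[of "\<lambda>k. u (2 * k + 1)" t "S n y' + err"] u_lo by auto
  moreover have "S n y' + 2 * err < S n y" using gap by (simp only: S_def err_def)
  ultimately show False by linarith
qed

section \<open>Pressure of the irregular set\<close>

text \<open>The choices are made in the order \<open>\<epsilon>\<close>, gap \<open>m\<close>,
  window parameter \<open>q\<close>, block length \<open>n\<close>. The five losses of
  \<open>\<gamma>\<close> are: finite-time entropy, the separated-sum estimate, the windows, the
  modulus of \<open>\<psi>\<close>, and the gaps.\<close>

lemma irregular_pressure_at_scale_lower_bound:
  fixes f :: "'a::metric_space \<Rightarrow> 'a"
  assumes \<mu>: "invariant_prob f \<mu>" and X': "emeasure \<mu> X' = 1"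
    and \<mu>1: "invariant_prob f \<mu>1" "emeasure \<mu>1 X' = 1"
    and \<mu>2: "invariant_prob f \<mu>2" "emeasure \<mu>2 X' = 1"
    and osc: "(\<integral>x. \<phi> x \<partial>\<mu>1) < (\<integral>x. \<phi> x \<partial>\<mu>2)"
    and spec: "specification_on f X'"
    and \<phi>: "continuous_on UNIV \<phi>" and \<psi>: "continuous_on UNIV \<psi>" and \<gamma>: "\<gamma> > 0"
    and finP: "finite P" and P_sets: "P \<subseteq> sets \<mu>" and P: "partition_on UNIV P"
  shows "eventually (\<lambda>\<epsilon>. ereal (partition_dynamical_entropy \<mu> f P + (\<integral>x. \<psi> x \<partial>\<mu>) - 5 * \<gamma>)
    \<le> pressure_at_scale f (irregular_set f \<phi>) \<psi> \<epsilon>) (at_right 0)"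
proof -
  interpret invariant_prob f \<mu> by (rule \<mu>)
  interpret M1: invariant_prob f \<mu>1 by (rule \<mu>1)
  interpret M2: invariant_prob f \<mu>2 by (rule \<mu>2)
  \<comment> \<open>An eighth of the gap: choosing \<open>y\<close> and \<open>y'\<close> costs two
    \<open>\<delta>\<close>, leaving six per unit of block length, while shadowing and gaps in the
    even and odd windows cost at most four.\<close>
  define \<delta> where "\<delta> = ((\<integral>x. \<phi> x \<partial>\<mu>2) - (\<integral>x. \<phi> x \<partial>\<mu>1)) / 8"
  have \<delta>: "\<delta> > 0" using osc by (simp add: \<delta>_def)
  obtain B where B: "B \<ge> 0" "\<And>x. \<bar>\<psi> x\<bar> \<le> B" using continuous_bounded[OF \<psi>] by blast
  obtain C where C: "C \<ge> 0" "\<And>x. \<bar>\<phi> x\<bar> \<le> C" using continuous_bounded[OF \<phi>] by blast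
  obtain d1 where d1: "d1 > 0" "\<And>\<epsilon> n. 0 < \<epsilon> \<Longrightarrow> \<epsilon> < d1 \<Longrightarrow> \<exists>E\<in>separated_sets f n (4 * \<epsilon>). E \<subseteq> X' \<and> E \<noteq> {} \<and>
      partition_entropy \<mu> (iterated_join f P n) + real n * (\<integral>x. \<psi> x \<partial>\<mu>) - real n * \<gamma>
        \<le> ln (\<Sum>e\<in>E. exp (birkhoff_sum f \<psi> n e))"
    by (rule separated_sum_ge_entropy[OF X' \<psi> \<gamma> finP P_sets P]) (rule that)
  obtain d2 where d2: "d2 > 0" "\<And>x y. dist x y \<le> d2 \<Longrightarrow> \<bar>\<psi> x - \<psi> y\<bar> \<le> \<gamma>"
    using uniform_modulus[OF \<psi> \<gamma>] by blast
  obtain d3 where d3: "d3 > 0" "\<And>x y. dist x y \<le> d3 \<Longrightarrow> \<bar>\<phi> x - \<phi> y\<bar> \<le> \<delta>"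
    using uniform_modulus[OF \<phi> \<delta>] by blast
  define h where "h = partition_dynamical_entropy \<mu> f P"
  define I where "I = (\<integral>x. \<psi> x \<partial>\<mu>)"
  have bound: "ereal (h + I - 5 * \<gamma>) \<le> pressure_at_scale f (irregular_set f \<phi>) \<psi> \<epsilon>"
    if \<epsilon>: "0 < \<epsilon>" "\<epsilon> < min d1 (min d2 d3)" for \<epsilon>
  proof -
    obtain m where m: "\<And>k a b x. (\<forall>j<k. a j \<le> b j \<and> x j \<in> X') \<Longrightarrow> (\<forall>j. Suc j < k \<longrightarrow> b j + m \<le> a (Suc j))
        \<Longrightarrow> \<exists>z. \<forall>j<k. \<forall>p\<le>b j - a j. dist ((f ^^ (p + a j)) z) ((f ^^ p) (x j)) < \<epsilon>"
      using spec[unfolded specification_on_def, rule_format, OF \<epsilon>(1)] by blast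
    define P0 where "P0 = h + I - 2 * \<gamma>"
    \<comment> \<open>A prescribed block loses at most \<open>n * (B + \<bar>P0\<bar>)\<close> and
      the windows have proportion at most \<open>2 / q\<close>, so this \<open>q\<close> keeps their
      total cost within \<open>\<gamma>\<close>.\<close>
    obtain q :: nat where "real q > 2 * (B + \<bar>P0\<bar>) / \<gamma>" using reals_Archimedean2 by blast
    moreover have "0 \<le> 2 * (B + \<bar>P0\<bar>) / \<gamma>" using B(1) \<gamma> by simp
    ultimately have q: "q > 0" "2 * (B + \<bar>P0\<bar>) \<le> real q * \<gamma>"
      using \<gamma> by (auto simp: field_simps intro: Nat.gr0I)
    have lin: "eventually (\<lambda>n. c \<le> real n * e) sequentially" if "e > 0" for c e :: real
    proof -
      obtain n0 :: nat where n0: "real n0 > c / e" using reals_Archimedean2 by blast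
      have "c \<le> real n * e" if "n \<ge> n0" for n
      proof -
        have "c / e < real n" using n0 that by (meson less_le_trans of_nat_mono)
        thus ?thesis using \<open>e > 0\<close> by (simp add: field_simps)
      qed
      thus ?thesis unfolding eventually_sequentially by blast
    qed
    have "eventually (\<lambda>n. h - \<gamma> < partition_entropy \<mu> (iterated_join f P n) / real n) sequentially"
      unfolding h_def
      by (rule order_tendstoD(1)[OF partition_dynamical_entropy_tendsto[OF finP P_sets P]]) (use \<gamma> in simp)
    hence "eventually (\<lambda>n. (h - \<gamma> < partition_entropy \<mu> (iterated_join f P n) / real n \<and> n \<ge> 1) \<and>
        real m * C \<le> real n * \<delta> \<and> real m * (B + \<bar>P0 - \<gamma>\<bar>) \<le> real n * \<gamma>) sequentially"
      by (intro eventually_conj eventually_ge_at_top lin \<gamma> \<delta>)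
    from eventually_happens'[OF sequentially_bot this] obtain n where
      n: "h - \<gamma> < partition_entropy \<mu> (iterated_join f P n) / real n" "n \<ge> 1"
        "real m * C \<le> real n * \<delta>" "real m * (B + \<bar>P0 - \<gamma>\<bar>) \<le> real n * \<gamma>" by blast
    hence n0: "n > 0" by simp
    define S where "S = birkhoff_sum f \<psi> n"
    obtain y where y: "y \<in> X'" "real n * ((\<integral>x. \<phi> x \<partial>\<mu>2) - \<delta>) \<le> birkhoff_sum f \<phi> n y"
      by (rule M2.exists_birkhoff_sum_ge[OF \<mu>2(2) \<phi> n0, of "(\<integral>x. \<phi> x \<partial>\<mu>2) - \<delta>"]) (use \<delta> in auto)
    obtain y' where y': "y' \<in> X'" "birkhoff_sum f \<phi> n y' \<le> real n * ((\<integral>x. \<phi> x \<partial>\<mu>1) + \<delta>)"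
      by (rule M1.exists_birkhoff_sum_le[OF \<mu>1(2) \<phi> n0, of "(\<integral>x. \<phi> x \<partial>\<mu>1) + \<delta>"]) (use \<delta> in auto)
    have "\<exists>E\<in>separated_sets f n (4 * \<epsilon>). E \<subseteq> X' \<and> E \<noteq> {} \<and>
      partition_entropy \<mu> (iterated_join f P n) + real n * I - real n * \<gamma> \<le> ln (\<Sum>e\<in>E. exp (S e))"
      unfolding I_def S_def using \<epsilon> by (intro d1(2)) simp_all
    then obtain E0 where E0: "E0 \<in> separated_sets f n (4 * \<epsilon>)" "E0 \<subseteq> X'" "E0 \<noteq> {}"
      "partition_entropy \<mu> (iterated_join f P n) + real n * I - real n * \<gamma> \<le> ln (\<Sum>e\<in>E0. exp (S e))" by blast
    have Z0: "real n * P0 \<le> ln (\<Sum>e\<in>E0. exp (S e))"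
    proof -
      have "real n * (h - \<gamma>) \<le> partition_entropy \<mu> (iterated_join f P n)"
        using n(1) n0 by (simp add: field_simps)
      moreover have "real n * P0 = real n * (h - \<gamma>) + real n * I - real n * \<gamma>"
        by (simp add: P0_def algebra_simps)
      ultimately show ?thesis using E0(4) by linarith
    qed
    define E where "E j = (if \<exists>k. even k \<and> j \<in> window q k then {y}
        else if \<exists>k. odd k \<and> j \<in> window q k then {y'} else E0)" for j
    define W where "W = (\<Union>k. window q k)"
    have E_sub: "E j \<subseteq> X'" for j using E0(2) y(1) y'(1) by (simp add: E_def)
    have lnZ: "real n * P0 - (if j \<in> W then real n * (B + \<bar>P0\<bar>) else 0) \<le> ln (\<Sum>e\<in>E j. exp (S e))" for j
    proof (cases "j \<in> W")
      case True
      then obtain k where "j \<in> window q k" by (auto simp: W_def)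
      hence "(\<exists>k. even k \<and> j \<in> window q k) \<or> (\<exists>k. odd k \<and> j \<in> window q k)" by blast
      hence "E j = {y} \<or> E j = {y'}" unfolding E_def by argo
      then obtain w where "E j = {w}" by blast
      hence "ln (\<Sum>e\<in>E j. exp (S e)) = S w" by simp
      moreover have "\<bar>S w\<bar> \<le> real n * B" unfolding S_def by (rule abs_birkhoff_sum_le[OF B(2)])
      moreover have "real n * P0 \<le> real n * \<bar>P0\<bar>" by (intro mult_left_mono) auto
      moreover have "real n * (B + \<bar>P0\<bar>) = real n * B + real n * \<bar>P0\<bar>" by (rule distrib_left)
      ultimately show ?thesis using True by simp
    next
      case False
      hence "E j = E0" by (auto simp: E_def W_def)
      thus ?thesis using Z0 False by simp
    qed
    \<comment> \<open>The rate is rescaled because the gaps take time without contributing any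
      choice; the subtracted \<open>\<gamma>\<close> pays for the windows.\<close>
    define A where "A = real n / real (n + m) * (P0 - \<gamma>)"
    have "ereal (A - \<gamma> - real m / real (n + m) * B) \<le> pressure_at_scale f (irregular_set f \<phi>) \<psi> \<epsilon>"
    proof (rule moran_pressure_lower_bound[OF \<psi> B \<epsilon>(1) _ _ n0, where E = E])
      show "\<gamma> \<ge> 0" using \<gamma> by simp
      show "\<bar>\<psi> x - \<psi> y\<bar> \<le> \<gamma>" if "dist x y \<le> \<epsilon>" for x y using that \<epsilon> by (intro d2(2)) simp
      show "E j \<in> separated_sets f n (4 * \<epsilon>)" for j
        using E0(1) by (auto simp: E_def separated_sets_def)
      show "E j \<noteq> {}" for j using E0(3) by (simp add: E_def)
      show "\<exists>z. \<forall>j<M. \<forall>p<n. dist ((f ^^ (p + j * (n + m))) z) ((f ^^ p) (\<omega> j)) < \<epsilon>"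
        if \<omega>: "\<And>j. j < M \<Longrightarrow> \<omega> j \<in> E j" for M \<omega>
      proof -
        \<comment> \<open>Specification uses closed intervals, so block \<open>j\<close> ends at
          \<open>j * (n + m) + (n - 1)\<close>, and the next start is at distance
          \<open>m + 1\<close>, one more than required.\<close>
        have "\<exists>z. \<forall>j<M. \<forall>p\<le>(j * (n + m) + (n - 1)) - j * (n + m). dist ((f ^^ (p + j * (n + m))) z) ((f ^^ p) (\<omega> j)) < \<epsilon>"
        proof (rule m)
          show "\<forall>j<M. j * (n + m) \<le> j * (n + m) + (n - 1) \<and> \<omega> j \<in> X'"
            using \<omega> E_sub by auto
        qed auto
        then obtain z where z: "\<forall>j<M. \<forall>p\<le>(j * (n + m) + (n - 1)) - j * (n + m).
          dist ((f ^^ (p + j * (n + m))) z) ((f ^^ p) (\<omega> j)) < \<epsilon>" by blast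
        show ?thesis
        proof (intro exI[of _ z] allI impI)
          fix j p assume jp: "j < M" "p < n"
          hence "p \<le> (j * (n + m) + (n - 1)) - j * (n + m)" by simp
          thus "dist ((f ^^ (p + j * (n + m))) z) ((f ^^ p) (\<omega> j)) < \<epsilon>" using z jp(1) by blast
        qed
      qed
      show "real r * real (n + m) * A \<le> (\<Sum>j<r. ln (\<Sum>e\<in>E j. exp (birkhoff_sum f \<psi> n e)))" for r
      proof -
        define J where "J = {..<r} \<inter> W"
        have "q * card J \<le> 2 * r" unfolding J_def W_def by (rule card_windows_le)
        hence "real q * real (card J) \<le> 2 * real r" by (simp flip: of_nat_mult)
        hence "real q * real (card J) * (B + \<bar>P0\<bar>) \<le> 2 * real r * (B + \<bar>P0\<bar>)"
          using B(1) by (intro mult_right_mono) auto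
        also have "\<dots> = real r * (2 * (B + \<bar>P0\<bar>))" by simp
        also have "\<dots> \<le> real r * (real q * \<gamma>)" using q(2) by (intro mult_left_mono) auto
        finally have "real q * (real (card J) * (B + \<bar>P0\<bar>)) \<le> real q * (real r * \<gamma>)"
          by (simp only: mult.assoc mult.left_commute)
        hence J: "real (card J) * (B + \<bar>P0\<bar>) \<le> real r * \<gamma>" using q(1) by simp
        have "real r * real (n + m) * A = real r * (real n * (P0 - \<gamma>))"
          using n0 unfolding A_def by simp
        also have "\<dots> = real r * (real n * P0) - real n * (real r * \<gamma>)" by (simp add: algebra_simps)
        also have "\<dots> \<le> real r * (real n * P0) - real n * (real (card J) * (B + \<bar>P0\<bar>))"
          using J by (intro diff_left_mono mult_left_mono) auto
        also have "\<dots> = (\<Sum>j<r. real n * P0) - (\<Sum>j<r. if j \<in> W then real n * (B + \<bar>P0\<bar>) else 0)"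
          by (simp add: J_def sum.inter_restrict[symmetric])
        also have "\<dots> = (\<Sum>j<r. real n * P0 - (if j \<in> W then real n * (B + \<bar>P0\<bar>) else 0))"
          by (rule sum_subtractf[symmetric])
        also have "\<dots> \<le> (\<Sum>j<r. ln (\<Sum>e\<in>E j. exp (S e)))" by (intro sum_mono lnZ)
        finally show ?thesis unfolding S_def .
      qed
      show "z \<in> irregular_set f \<phi>"
        if z: "\<And>j. \<exists>e\<in>E j. \<forall>p<n. dist ((f ^^ (p + j * (n + m))) z) ((f ^^ p) e) \<le> \<epsilon>" for z
      proof (rule irregular_if_oscillating_windows[OF C(2) q(1) n0, where v = \<delta> and m = m])
        fix k j p assume k: "even k" "j \<in> window q k" "p < n"
        hence even: "\<exists>k. even k \<and> j \<in> window q k" by blast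
        have "E j = {y}" unfolding E_def if_P[OF even] ..
        thus "\<bar>\<phi> ((f ^^ (p + j * (n + m))) z) - \<phi> ((f ^^ p) y)\<bar> \<le> \<delta>"
          using z[of j] k(3) \<epsilon> by (intro d3(2)) fastforce
      next
        fix k j p assume k: "odd k" "j \<in> window q k" "p < n"
        \<comment> \<open>Disjointness of the windows rules out the first branch in the definition
          of \<open>E j\<close>.\<close>
        have even: "\<not> (\<exists>l. even l \<and> j \<in> window q l)"
          using window_disjoint[OF q(1) k(2)] k(1) by blast
        have odd: "\<exists>k. odd k \<and> j \<in> window q k" using k by blast
        have "E j = {y'}" unfolding E_def if_not_P[OF even] if_P[OF odd] ..
        thus "\<bar>\<phi> ((f ^^ (p + j * (n + m))) z) - \<phi> ((f ^^ p) y')\<bar> \<le> \<delta>"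
          using z[of j] k(3) \<epsilon> by (intro d3(2)) fastforce
      next
        have "real n * ((\<integral>x. \<phi> x \<partial>\<mu>2) - \<delta>) = real n * ((\<integral>x. \<phi> x \<partial>\<mu>1) + \<delta>) + 6 * (real n * \<delta>)"
          by (simp add: \<delta>_def field_simps)
        moreover have "real n * \<delta> > 0" using n0 \<delta> by simp
        ultimately show "birkhoff_sum f \<phi> n y' + 2 * (real n * \<delta> + real m * C) < birkhoff_sum f \<phi> n y"
          using y(2) y'(2) n(3) unfolding distrib_left[of 2] by linarith
      qed
    qed
    moreover have "h + I - 5 * \<gamma> \<le> A - \<gamma> - real m / real (n + m) * B"
    proof -
      define \<theta> where "\<theta> = real m / real (n + m)"
      have "real n / real (n + m) = 1 - \<theta>" using n0 by (simp add: \<theta>_def field_simps)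
      hence "A = (P0 - \<gamma>) - \<theta> * (P0 - \<gamma>)" unfolding A_def by (simp only: left_diff_distrib mult_1)
      moreover have "\<theta> * (P0 - \<gamma>) \<le> \<theta> * \<bar>P0 - \<gamma>\<bar>" by (intro mult_left_mono) (auto simp: \<theta>_def)
      moreover have "\<theta> * (B + \<bar>P0 - \<gamma>\<bar>) \<le> \<gamma>"
      proof -
        have "real n * \<gamma> \<le> real (n + m) * \<gamma>" using \<gamma> by (intro mult_right_mono) auto
        hence "real m * (B + \<bar>P0 - \<gamma>\<bar>) \<le> real (n + m) * \<gamma>" using n(4) by linarith
        thus ?thesis using n0 by (simp add: \<theta>_def pos_divide_le_eq mult.commute)
      qed
      moreover have "\<theta> * (B + \<bar>P0 - \<gamma>\<bar>) = \<theta> * B + \<theta> * \<bar>P0 - \<gamma>\<bar>" by (rule distrib_left)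
      ultimately have "P0 - \<gamma> - \<gamma> - \<gamma> \<le> A - \<gamma> - \<theta> * B" by linarith
      thus ?thesis by (simp add: P0_def \<theta>_def)
    qed
    ultimately show ?thesis by (meson ereal_less_eq(3) order_trans)
  qed
  show ?thesis
  proof (rule eventually_at_rightI)
    show "0 < min d1 (min d2 d3)" using d1(1) d2(1) d3(1) by simp
    fix \<epsilon> assume "\<epsilon> \<in> {0<..<min d1 (min d2 d3)}"
    thus "ereal (partition_dynamical_entropy \<mu> f P + (\<integral>x. \<psi> x \<partial>\<mu>) - 5 * \<gamma>)
        \<le> pressure_at_scale f (irregular_set f \<phi>) \<psi> \<epsilon>"
      using bound unfolding h_def I_def by simp
  qed
qed

theorem theorem2p2:
  fixes f :: "'a::metric_space \<Rightarrow> 'a"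
    and X' :: "'a set"
    and \<phi> :: "'a \<Rightarrow> real"
  assumes "compact (UNIV :: 'a set)"
    and "continuous_on UNIV f"
    and "f ` X' \<subseteq> X'"
    and "specification_on f X'"
    and "continuous_on UNIV \<phi>"
    and "(INF \<mu>\<in>invariant_measures_on f X'. ereal (\<integral>x. \<phi> x \<partial>\<mu>))
       < (SUP \<mu>\<in>invariant_measures_on f X'. ereal (\<integral>x. \<phi> x \<partial>\<mu>))"
  shows "\<forall>\<psi> :: 'a \<Rightarrow> real. continuous_on UNIV \<psi> \<longrightarrow>
      topological_pressure f (irregular_set f \<phi>) \<psi>
        \<ge> (SUP \<mu>\<in>invariant_measures_on f X'. measure_entropy \<mu> f + ereal (\<integral>x. \<psi> x \<partial>\<mu>))
    \<and> ((SUP \<mu>\<in>invariant_measures_on f X'. measure_entropy \<mu> f + ereal (\<integral>x. \<psi> x \<partial>\<mu>))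
          = classic_pressure f \<psi>
        \<longrightarrow> topological_pressure f (irregular_set f \<phi>) \<psi> = classic_pressure f \<psi>)"
proof (intro allI impI)
  fix \<psi> :: "'a \<Rightarrow> real" assume \<psi>: "continuous_on UNIV \<psi>"
  interpret compact_system f by unfold_locales (fact assms(1) assms(2))+
  let ?T = "topological_pressure f (irregular_set f \<phi>) \<psi>"
  have inv: "invariant_prob f \<mu>" "emeasure \<mu> X' = 1" if "\<mu> \<in> invariant_measures_on f X'" for \<mu>
  proof -
    have \<mu>: "sets \<mu> = sets borel" "prob_space \<mu>" "distr \<mu> \<mu> f = \<mu>" "emeasure \<mu> X' = 1"
      using that by (auto simp: invariant_measures_on_def invariant_measures_def)
    show "emeasure \<mu> X' = 1" by (rule \<mu>(4))
    show "invariant_prob f \<mu>"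
      by (intro invariant_prob.intro compact_system_axioms \<mu>(2) invariant_prob_axioms.intro \<mu>(1,3))
  qed
  \<comment> \<open>The strict inequality between infimum and supremum supplies two measures with
    different means of \<open>\<phi>\<close>, which drive the oscillation; the measure
    \<open>\<mu>\<close> providing entropy is independent of them.\<close>
  obtain \<mu>2 where \<mu>2: "\<mu>2 \<in> invariant_measures_on f X'"
    "(INF \<mu>\<in>invariant_measures_on f X'. ereal (\<integral>x. \<phi> x \<partial>\<mu>)) < ereal (\<integral>x. \<phi> x \<partial>\<mu>2)"
    using assms(6) unfolding less_SUP_iff by blast
  then obtain \<mu>1 where \<mu>1: "\<mu>1 \<in> invariant_measures_on f X'"
    "(\<integral>x. \<phi> x \<partial>\<mu>1) < (\<integral>x. \<phi> x \<partial>\<mu>2)"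
    unfolding INF_less_iff by auto
  have lower: "measure_entropy \<mu> f + ereal (\<integral>x. \<psi> x \<partial>\<mu>) \<le> ?T"
    if \<mu>: "\<mu> \<in> invariant_measures_on f X'" for \<mu>
  proof -
    interpret M: invariant_prob f \<mu> by (rule inv(1)[OF \<mu>])
    \<comment> \<open>The finite integral is moved to the right, so that the supremum over
      partitions, possibly infinite, can be bounded one partition at a time.\<close>
    have "measure_entropy \<mu> f \<le> ?T - ereal (\<integral>x. \<psi> x \<partial>\<mu>)"
      unfolding measure_entropy_def
    proof (rule SUP_least)
      fix P assume "P \<in> {P. finite P \<and> P \<subseteq> sets \<mu> \<and> partition_on (space \<mu>) P}"
      hence P: "finite P" "P \<subseteq> sets \<mu>" "partition_on UNIV P" by (simp_all add: M.space_eq)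
      let ?h = "partition_dynamical_entropy \<mu> f P + (\<integral>x. \<psi> x \<partial>\<mu>)"
      have "ereal ?h \<le> ?T"
      proof (rule ereal_le_epsilon2)
        fix e :: real assume "e > 0"
        hence "e / 5 > 0" by simp
        have "ereal (?h - 5 * (e / 5)) \<le> ?T"
          by (rule tendsto_lowerbound[OF pressure_at_scale_tendsto[OF \<psi>]
              irregular_pressure_at_scale_lower_bound[OF inv[OF \<mu>] inv[OF \<mu>1(1)] inv[OF \<mu>2(1)] \<mu>1(2)
                assms(4,5) \<psi> \<open>e / 5 > 0\<close> P] trivial_limit_at_right_real])
        hence "ereal ?h - ereal e \<le> ?T" by simp
        thus "ereal ?h \<le> ?T + ereal e" by (subst (asm) ereal_minus_le) auto
      qed
      hence "ereal (partition_dynamical_entropy \<mu> f P) + ereal (\<integral>x. \<psi> x \<partial>\<mu>) \<le> ?T" by simp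
      thus "ereal (partition_dynamical_entropy \<mu> f P) \<le> ?T - ereal (\<integral>x. \<psi> x \<partial>\<mu>)"
        by (subst ereal_le_minus) auto
    qed
    thus ?thesis by (subst (asm) ereal_le_minus) auto
  qed
  have le: "(SUP \<mu>\<in>invariant_measures_on f X'. measure_entropy \<mu> f + ereal (\<integral>x. \<psi> x \<partial>\<mu>)) \<le> ?T"
    by (rule SUP_least) (rule lower)
  show "?T \<ge> (SUP \<mu>\<in>invariant_measures_on f X'. measure_entropy \<mu> f + ereal (\<integral>x. \<psi> x \<partial>\<mu>))
    \<and> ((SUP \<mu>\<in>invariant_measures_on f X'. measure_entropy \<mu> f + ereal (\<integral>x. \<psi> x \<partial>\<mu>))
          = classic_pressure f \<psi> \<longrightarrow> ?T = classic_pressure f \<psi>)"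
    \<comment> \<open>The classical pressure bounds the pressure of any set from above, so equality
      in the hypothesis closes the chain of inequalities.\<close>
    using le topological_pressure_le_classic[OF \<psi>, of "irregular_set f \<phi>"] by auto
qed

end
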